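(* If $H$ is a path, then \textsc{Colorful $H$-Subgraph Hitting} is solvable in polynomial time.
   Context: An $H$-coloring of a graph $G$ is a function $\sigma:V(G)\to V(H)$. A $\sigma$-$H$-subgraph of $G$ is an injective map $\pi:V(H)\to V(G)$ with $\pi(a)\pi(b)\in E(G)$ whenever $ab\in E(H)$ and $\sigma(\pi(a))=a$ for all $a\in V(H)$; $X\subseteq V(G)$ hits it if $X\cap\pi(V(H))\ne\emptyset$. \textsc{Colorful $H$-Subgraph Hitting}: given $G$ and an $H$-coloring $\sigma$, compute the minimum size of a set $X\subseteq V(G)$ hitting all $\sigma$-$H$-subgraphs of $G$. $H$ is fixed. *)

theory Defs
  imports
    "Graph_Theory.Pair_Digraph"
    "HOL-Computational_Algebra.Polynomial"
    "HOL-Library.FuncSet"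
    "HOL-Library.Log_Nat"
begin

section \<open>Polynomial-time computability\<close>

text \<open>
  The machine model is a random access machine, presented as a structured while-language.
  It has registers and a memory, both indexed by natural numbers and holding natural numbers.
  A program mentions only finitely many fixed registers, whereas memory is addressed indirectly.
  Every instruction and every node of an expression costs one unit of time. There is addition
  and truncated subtraction, but deliberately no multiplication: the bit length of the largest
  number in use grows by at most one per time unit, so that a computation with polynomially
  many unit-cost steps is a polynomial-time computation in the sense of Turing machines, and
  vice versa.
\<close>

datatype exp =
    Const nat
  | Reg nat
  | Mem exp
  | Add exp exp
  | Sub exp exp

datatype com =
    Skip
  | Assign nat exp
  | Store exp exp
  | Seq com com
  | Cond exp com com
  | While exp com

type_synonym state = "(nat \<Rightarrow> nat) \<times> (nat \<Rightarrow> nat)"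

fun val :: "exp \<Rightarrow> state \<Rightarrow> nat" where
  "val (Const k) s = k"
| "val (Reg i) s = fst s i"
| "val (Mem e) s = snd s (val e s)"
| "val (Add e f) s = val e s + val f s"
| "val (Sub e f) s = val e s - val f s"

fun cost :: "exp \<Rightarrow> nat" where
  "cost (Const k) = 1"
| "cost (Reg i) = 1"
| "cost (Mem e) = 1 + cost e"
| "cost (Add e f) = 1 + cost e + cost f"
| "cost (Sub e f) = 1 + cost e + cost f"

text \<open>\<open>exec c s t s'\<close>: started in state \<open>s\<close>, the program \<open>c\<close> halts in state \<open>s'\<close> after
  exactly \<open>t\<close> units of time. A condition is true if its value is nonzero.\<close>

inductive exec :: "com \<Rightarrow> state \<Rightarrow> nat \<Rightarrow> state \<Rightarrow> bool" where
  Skip: "exec Skip s 1 s"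
| Assign: "exec (Assign i e) (R, M) (1 + cost e) (R(i := val e (R, M)), M)"
| Store: "exec (Store e f) (R, M) (1 + cost e + cost f) (R, M(val e (R, M) := val f (R, M)))"
| Seq: "exec c s t s' \<Longrightarrow> exec d s' u s'' \<Longrightarrow> exec (Seq c d) s (t + u) s''"
| CondTrue: "val e s \<noteq> 0 \<Longrightarrow> exec c s t s' \<Longrightarrow> exec (Cond e c d) s (1 + cost e + t) s'"
| CondFalse: "val e s = 0 \<Longrightarrow> exec d s t s' \<Longrightarrow> exec (Cond e c d) s (1 + cost e + t) s'"
| WhileFalse: "val e s = 0 \<Longrightarrow> exec (While e c) s (1 + cost e) s"
| WhileTrue: "val e s \<noteq> 0 \<Longrightarrow> exec c s t s' \<Longrightarrow> exec (While e c) s' u s'' \<Longrightarrow>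
    exec (While e c) s (1 + cost e + t + u) s''"

text \<open>The input word is stored from memory address 0 on, and its length in register 0.
  All other registers and memory cells are initially 0.\<close>

definition init_state :: "nat list \<Rightarrow> state" where
  "init_state xs =
    ((\<lambda>_. 0)(0 := length xs), (\<lambda>a. if a < length xs then xs ! a else 0))"

text \<open>The size of an input is its length in bits, with one extra bit per number as separator;
  \<open>floorlog 2 x\<close> is the number of binary digits of \<open>x\<close>.\<close>

definition input_size :: "nat list \<Rightarrow> nat" where
  "input_size xs = (\<Sum>x\<leftarrow>xs. 1 + floorlog 2 x)"

text \<open>A problem is given by its set of instances \<open>I\<close>, their encoding \<open>enc\<close>, and the number
  \<open>f x\<close> that is to be computed for each instance \<open>x\<close>. The result is delivered in register 0.\<close>

definition poly_time_solvable :: "('i \<Rightarrow> nat list) \<Rightarrow> 'i set \<Rightarrow> ('i \<Rightarrow> nat) \<Rightarrow> bool" where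
  "poly_time_solvable enc I f \<longleftrightarrow>
    (\<exists>(c :: com) (p :: nat poly). \<forall>x\<in>I. \<exists>t s.
       exec c (init_state (enc x)) t s \<and>
       t \<le> poly p (input_size (enc x)) \<and>
       fst s 0 = f x)"

section \<open>Colorful subgraph hitting\<close>

text \<open>A finite simple undirected graph is a \<^locale>\<open>pair_graph\<close>: a finite, loop-free digraph
  without parallel arcs whose arc relation is symmetric.\<close>

definition path_graph :: "'h pair_pre_digraph \<Rightarrow> bool" where
  "path_graph H \<longleftrightarrow> pair_graph H \<and>
    (\<exists>vs. vs \<noteq> [] \<and> distinct vs \<and> pverts H = set vs \<and>
      parcs H = {(vs ! i, vs ! Suc i) | i. Suc i < length vs} \<union>
                {(vs ! Suc i, vs ! i) | i. Suc i < length vs})"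

definition is_coloring :: "'h pair_pre_digraph \<Rightarrow> 'g pair_pre_digraph \<Rightarrow> ('g \<Rightarrow> 'h) \<Rightarrow> bool" where
  "is_coloring H G \<sigma> \<longleftrightarrow> \<sigma> \<in> pverts G \<rightarrow> pverts H"

definition colorful_subgraph ::
  "'h pair_pre_digraph \<Rightarrow> 'g pair_pre_digraph \<Rightarrow> ('g \<Rightarrow> 'h) \<Rightarrow> ('h \<Rightarrow> 'g) \<Rightarrow> bool" where
  "colorful_subgraph H G \<sigma> \<pi> \<longleftrightarrow>
     \<pi> \<in> pverts H \<rightarrow> pverts G \<and> inj_on \<pi> (pverts H) \<and>
     (\<forall>a b. (a, b) \<in> parcs H \<longrightarrow> (\<pi> a, \<pi> b) \<in> parcs G) \<and>
     (\<forall>a\<in>pverts H. \<sigma> (\<pi> a) = a)"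

definition hitting_set ::
  "'h pair_pre_digraph \<Rightarrow> 'g pair_pre_digraph \<Rightarrow> ('g \<Rightarrow> 'h) \<Rightarrow> 'g set \<Rightarrow> bool" where
  "hitting_set H G \<sigma> X \<longleftrightarrow> X \<subseteq> pverts G \<and>
     (\<forall>\<pi>. colorful_subgraph H G \<sigma> \<pi> \<longrightarrow> X \<inter> \<pi> ` pverts H \<noteq> {})"

text \<open>If \<open>H\<close> has a vertex and \<open>G\<close> is finite, the minimum is over a nonempty finite set:
  \<open>pverts G\<close> itself is a hitting set.\<close>

definition hitting_number ::
  "'h pair_pre_digraph \<Rightarrow> 'g pair_pre_digraph \<Rightarrow> ('g \<Rightarrow> 'h) \<Rightarrow> nat" where
  "hitting_number H G \<sigma> = Min (card ` {X. hitting_set H G \<sigma> X})"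

text \<open>Instances are graphs on \<open>{0, \<dots>, n - 1}\<close> for arbitrary \<open>n\<close>. They are encoded by \<open>n\<close>,
  the adjacency matrix in row-major order, and the list of the colors of the vertices. Since
  the vertices of \<open>H\<close> may be of any type, \<open>code\<close> assigns a number to each color.\<close>

definition hitting_instances ::
  "'h pair_pre_digraph \<Rightarrow> (nat pair_pre_digraph \<times> (nat \<Rightarrow> 'h)) set" where
  "hitting_instances H =
    {(G, \<sigma>). pair_graph G \<and> (\<exists>n. pverts G = {0..<n}) \<and> is_coloring H G \<sigma>}"

definition encode_instance ::
  "('h \<Rightarrow> nat) \<Rightarrow> nat pair_pre_digraph \<times> (nat \<Rightarrow> 'h) \<Rightarrow> nat list" where
  "encode_instance code = (\<lambda>(G, \<sigma>). let n = card (pverts G) in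
     n # [if (u, v) \<in> parcs G then 1 else 0. u \<leftarrow> [0..<n], v \<leftarrow> [0..<n]]
       @ [code (\<sigma> v). v \<leftarrow> [0..<n]])"

text \<open>The graph \<open>H\<close> is fixed: it is not part of the input, and both the program and the
  polynomial may depend on it and on the numbering of its vertices.\<close>

definition hitting_poly_time_solvable :: "'h pair_pre_digraph \<Rightarrow> bool" where
  "hitting_poly_time_solvable H \<longleftrightarrow>
    (\<forall>code. inj_on code (pverts H) \<longrightarrow>
      poly_time_solvable (encode_instance code) (hitting_instances H)
        (\<lambda>(G, \<sigma>). hitting_number H G \<sigma>))"

end

theory Submission
  imports Defs
begin

text \<open>Split every vertex into an out-copy on the left and an in-copy on the right of a bipartite
  graph; join \<open>u\<close> to \<open>w\<close> if \<open>uw\<close> is an edge from one layer to the next, and join the two copies of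
  every vertex of an inner layer. A hitting set \<open>X\<close> yields a vertex cover of size \<open>|X|\<close> plus the number
  of inner vertices: cover an inner vertex on the right if it is reachable from the first layer
  outside \<open>X\<close>, on the left if it is not reachable, and on both sides if it is in \<open>X\<close>. Conversely, the
  inner vertices covered twice and the covered vertices of the two outer layers hit all paths. The
  minimum vertex cover of the bipartite graph has the size of a maximum matching, which is found by
  an auction: an unmatched vertex bids for its cheapest neighbor, whose price rises by one.\<close>

section \<open>The auction algorithm for bipartite matching\<close>

text \<open>\<open>own j = Suc i\<close> means that bidder \<open>i\<close> holds item
  \<open>j\<close>, and 0 that nobody does, which suits zero-initialised memory. The price
  comparison is complementary slackness up to 1; the last clause makes ownership a matching.\<close>

definition auction_inv ::
  "(nat \<Rightarrow> nat \<Rightarrow> bool) \<Rightarrow> nat \<Rightarrow> (nat \<Rightarrow> nat) \<Rightarrow> (nat \<Rightarrow> nat) \<Rightarrow> bool" where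
  "auction_inv adj n p own \<longleftrightarrow>
    (\<forall>j<n. p j \<le> n + 2 \<and> (p j = 0 \<longleftrightarrow> own j = 0)) \<and>
    (\<forall>j<n. \<forall>i. own j = Suc i \<longrightarrow> i < n \<and> adj i j \<and> (\<forall>j'<n. adj i j' \<longrightarrow> p j \<le> Suc (p j'))) \<and>
    (\<forall>j<n. \<forall>j'<n. own j = own j' \<longrightarrow> own j \<noteq> 0 \<longrightarrow> j = j')"

text \<open>A bidder gives up once every neighbor costs \<open>n + 2\<close>. Below this cap there
  are \<open>n + 1\<close> positive price levels, one more than items.\<close>

definition auction_settled ::
  "(nat \<Rightarrow> nat \<Rightarrow> bool) \<Rightarrow> nat \<Rightarrow> (nat \<Rightarrow> nat) \<Rightarrow> (nat \<Rightarrow> nat) \<Rightarrow> nat \<Rightarrow> bool" where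
  "auction_settled adj n p own i \<longleftrightarrow>
    (\<exists>j<n. own j = Suc i) \<or> (\<forall>j<n. adj i j \<longrightarrow> n + 2 \<le> p j)"

lemma
  assumes "auction_inv adj n p own" "j < n"
  shows auction_inv_price_le: "p j \<le> n + 2"
    and auction_inv_owned_iff: "own j = 0 \<longleftrightarrow> p j = 0"
    and auction_inv_bidder_less: "own j = Suc i \<Longrightarrow> i < n"
    and auction_inv_adj: "own j = Suc i \<Longrightarrow> adj i j"
    and auction_inv_slack: "own j = Suc i \<Longrightarrow> j' < n \<Longrightarrow> adj i j' \<Longrightarrow> p j \<le> Suc (p j')"
    and auction_inv_inj: "j' < n \<Longrightarrow> own j = own j' \<Longrightarrow> own j \<noteq> 0 \<Longrightarrow> j = j'"
  using assms unfolding auction_inv_def by blast+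

text \<open>The bidder takes a cheapest neighbor, so after the increment it is still within one of
  the others; for all other holders a raised price only weakens the bound to be met.
  \<open>p'\<close> and \<open>own'\<close> are prescribed only below \<open>n\<close> because they
  will be read off memory, where other data follow.\<close>

lemma auction_inv_bid:
  assumes inv: "auction_inv adj n p own"
    and i: "i < n" "\<forall>j<n. own j \<noteq> Suc i"
    and b: "b < n" "adj i b" "p b < n + 2" "\<forall>j<n. adj i j \<longrightarrow> p b \<le> p j"
    and p': "\<forall>j<n. p' j = (if j = b then Suc (p b) else p j)"
    and own': "\<forall>j<n. own' j = (if j = b then Suc i else own j)"
  shows "auction_inv adj n p' own'"
proof -
  have price: "p' j = (if j = b then Suc (p b) else p j)"
    and owner: "own' j = (if j = b then Suc i else own j)" if "j < n" for j
    using p' own' that by blast+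
  have mono: "p j \<le> p' j" if "j < n" for j using price[OF that] by simp
  have 1: "p' j \<le> n + 2 \<and> (p' j = 0 \<longleftrightarrow> own' j = 0)" if "j < n" for j
    using auction_inv_price_le[OF inv that] auction_inv_owned_iff[OF inv that] price[OF that] owner[OF that] b(3) by simp
  have 2: "i' < n \<and> adj i' j \<and> (\<forall>j'<n. adj i' j' \<longrightarrow> p' j \<le> Suc (p' j'))"
    if j: "j < n" "own' j = Suc i'" for j i'
  proof (cases "j = b")
    case True
    then have "i' = i" using j owner by simp
    moreover have "p' j \<le> Suc (p' j')" if "j' < n" "adj i j'" for j'
      using b(4) mono[of j'] price[OF j(1)] True that by (metis Suc_le_mono le_trans)
    ultimately show ?thesis using True i b by blast
  next
    case False
    then have *: "i' < n \<and> adj i' j \<and> (\<forall>j'<n. adj i' j' \<longrightarrow> p j \<le> Suc (p j'))"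
      using auction_inv_bidder_less[OF inv] auction_inv_adj[OF inv] auction_inv_slack[OF inv] j owner
      by simp
    moreover have "p' j \<le> Suc (p' j')" if "j' < n" "adj i' j'" for j'
      using * mono[of j'] price[OF j(1)] False that by (metis Suc_le_mono le_trans)
    ultimately show ?thesis by blast
  qed
  have 3: "j = j'" if "j < n" "j' < n" "own' j = own' j'" "own' j \<noteq> 0" for j j'
    using that owner[of j] owner[of j'] i(2) auction_inv_inj[OF inv, of j j'] by (metis)
  show ?thesis unfolding auction_inv_def using 1 2 3 by blast
qed

text \<open>Since there are more price levels than items, some positive level is not the price of any
  item. No bidder holding an item below that gap is adjacent to an item above it.\<close>

lemma auction_cover:
  assumes inv: "auction_inv adj n p own"
    and settled: "\<forall>i<n. auction_settled adj n p own i"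
  shows "\<exists>L R. L \<subseteq> {..<n} \<and> R \<subseteq> {..<n} \<and> (\<forall>i<n. \<forall>j<n. adj i j \<longrightarrow> i \<in> L \<or> j \<in> R) \<and>
    card L + card R \<le> card {j. j < n \<and> p j \<noteq> 0}"
proof -
  have "\<not> {1..n + 1} \<subseteq> p ` {..<n}"
  proof
    assume "{1..n + 1} \<subseteq> p ` {..<n}"
    then have "card {1..n + 1} \<le> card {..<n}"
      using card_mono[of "p ` {..<n}" "{1..n + 1}"] card_image_le[of "{..<n}" p] by simp
    then show False by simp
  qed
  then obtain l where l: "1 \<le> l" "l \<le> n + 1" "\<forall>j<n. p j \<noteq> l" by fastforce
  define J where "J = {j. j < n \<and> p j \<noteq> 0 \<and> p j < l}"
  define R where "R = {j. j < n \<and> l < p j}"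
  \<comment> \<open>Subtracting 1 undoes the shift in \<open>own\<close>; items in \<open>J\<close>
    have a positive price and hence an owner.\<close>
  define L where "L = (\<lambda>j. own j - 1) ` J"
  have "card L \<le> card J" unfolding L_def J_def by (rule card_image_le) simp
  moreover have "card J + card R = card (J \<union> R)"
    by (rule card_Un_disjoint[symmetric]) (auto simp: J_def R_def)
  moreover have "J \<union> R \<subseteq> {j. j < n \<and> p j \<noteq> 0}"
    by (auto simp: J_def R_def)
  then have "card (J \<union> R) \<le> card {j. j < n \<and> p j \<noteq> 0}" by (rule card_mono[rotated]) simp
  ultimately have "card L + card R \<le> card {j. j < n \<and> p j \<noteq> 0}" by simp
  moreover have "L \<subseteq> {..<n}"
  proof
    fix i assume "i \<in> L"
    then obtain j where j: "j < n" "p j \<noteq> 0" "i = own j - 1" by (auto simp: L_def J_def)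
    then have "own j = Suc i" using auction_inv_owned_iff[OF inv j(1)] by simp
    then show "i \<in> {..<n}" using auction_inv_bidder_less[OF inv j(1)] by simp
  qed
  moreover have "i \<in> L \<or> j \<in> R" if ij: "i < n" "j < n" "adj i j" for i j
  proof (rule disjCI)
    assume "j \<notin> R"
    moreover have "p j \<noteq> l" using l(3) ij(2) by blast
    ultimately have less: "p j < l" using ij(2) by (simp add: R_def)
    then have "\<not> n + 2 \<le> p j" using l(2) by simp
    then obtain j' where j': "j' < n" "own j' = Suc i"
      using settled ij unfolding auction_settled_def by blast
    \<comment> \<open>The gap absorbs the slack: \<open>p j' <= p j + 1 <= l\<close>, and no price
      equals \<open>l\<close>, so \<open>j'\<close> is below the gap too.\<close>
    then have "p j' \<le> Suc (p j)" "p j' \<noteq> 0"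
      using auction_inv_slack[OF inv j' ij(2,3)] auction_inv_owned_iff[OF inv j'(1)] by simp_all
    moreover have "p j' \<noteq> l" using l(3) j'(1) by blast
    ultimately have "j' \<in> J" using j'(1) less by (simp add: J_def)
    then show "i \<in> L" unfolding L_def using j'(2) by (metis diff_Suc_1 image_eqI)
  qed
  moreover have "R \<subseteq> {..<n}" by (auto simp: R_def)
  ultimately show ?thesis by blast
qed

text \<open>Weak duality: the owned items form a matching. An owned item outside \<open>R\<close>
  must have its owner in \<open>L\<close>, and owners of different items differ.\<close>

lemma auction_matching:
  assumes inv: "auction_inv adj n p own"
    and cover: "\<forall>i<n. \<forall>j<n. adj i j \<longrightarrow> i \<in> L \<or> j \<in> R"
    and fin: "finite L" "finite R"
  shows "card {j. j < n \<and> p j \<noteq> 0} \<le> card L + card R"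
proof -
  let ?J = "{j. j < n \<and> p j \<noteq> 0}"
  have owner: "own j = Suc (own j - 1) \<and> own j - 1 < n \<and> adj (own j - 1) j" if "j \<in> ?J" for j
  proof -
    have "own j = Suc (own j - 1)" using auction_inv_owned_iff[OF inv, of j] that by simp
    then show ?thesis
      using auction_inv_bidder_less[OF inv] auction_inv_adj[OF inv] that by blast
  qed
  have "inj_on (\<lambda>j. own j - 1) (?J - R)"
  proof (rule inj_onI)
    fix j j' assume *: "j \<in> ?J - R" "j' \<in> ?J - R" "own j - 1 = own j' - 1"
    then have "own j = own j'" "own j \<noteq> 0" using owner[of j] owner[of j'] by auto
    then show "j = j'" using auction_inv_inj[OF inv] * by blast
  qed
  moreover have "(\<lambda>j. own j - 1) ` (?J - R) \<subseteq> L" using owner cover by blast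
  ultimately have "card (?J - R) \<le> card L" by (rule card_inj_on_le) (rule fin)
  moreover have "card ?J \<le> card (?J - R) + card R"
    using diff_card_le_card_Diff[OF fin(2), of ?J] by linarith
  ultimately show ?thesis by simp
qed

section \<open>Hitting colorful paths and vertex covers\<close>

text \<open>Layers are positions of colors along the path. \<open>2 <= k\<close> separates the first
  layer from the last; a path with one vertex is handled by
  \<open>hitting_number_single\<close>.\<close>

locale layered_graph =
  fixes n k :: nat and E :: "(nat \<times> nat) set" and layer :: "nat \<Rightarrow> nat"
  assumes k: "2 \<le> k"
    and layer: "v < n \<Longrightarrow> layer v < k"
begin

definition inner :: "nat \<Rightarrow> bool" where
  "inner v \<longleftrightarrow> 1 \<le> layer v \<and> layer v < k - 1"

text \<open>The in-copy of a vertex of the first layer and the out-copy of one of the last are isolated.\<close>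

definition split_adj :: "nat \<Rightarrow> nat \<Rightarrow> bool" where
  "split_adj u w \<longleftrightarrow> (u = w \<and> inner u) \<or> ((u, w) \<in> E \<and> layer w = Suc (layer u))"

definition transversal_path :: "(nat \<Rightarrow> nat) \<Rightarrow> bool" where
  "transversal_path x \<longleftrightarrow> (\<forall>i<k. x i < n \<and> layer (x i) = i) \<and> (\<forall>i. Suc i < k \<longrightarrow> (x i, x (Suc i)) \<in> E)"

definition hits_paths :: "nat set \<Rightarrow> bool" where
  "hits_paths X \<longleftrightarrow> X \<subseteq> {..<n} \<and> (\<forall>x. transversal_path x \<longrightarrow> (\<exists>i<k. x i \<in> X))"

lemma layer_cases:
  assumes "v < n" shows "layer v = 0 \<or> inner v \<or> layer v = k - 1"
  using layer[OF assms] by (auto simp: inner_def)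

section \<open>From vertex covers to hitting sets\<close>

lemma hits_of_cover:
  assumes sub: "L \<subseteq> {..<n}" "R \<subseteq> {..<n}"
    and cover: "\<forall>i<n. \<forall>j<n. split_adj i j \<longrightarrow> i \<in> L \<or> j \<in> R"
  shows "\<exists>X. hits_paths X \<and> card X + card {v. v < n \<and> inner v} \<le> card L + card R"
proof -
  let ?I = "{v. v < n \<and> inner v}"
  define X0 where "X0 = {v\<in>L. layer v = 0}"
  define X1 where "X1 = {v\<in>R. layer v = k - 1}"
  define X2 where "X2 = L \<inter> R \<inter> ?I"
  have fin: "finite L" "finite R" using sub finite_subset by blast+
  have "hits_paths (X0 \<union> X1 \<union> X2)" unfolding hits_paths_def
  proof (intro conjI allI impI)
    show "X0 \<union> X1 \<union> X2 \<subseteq> {..<n}" using sub by (auto simp: X0_def X1_def X2_def)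
    fix x assume x: "transversal_path x"
    show "\<exists>i<k. x i \<in> X0 \<union> X1 \<union> X2"
    proof (rule ccontr)
      assume no: "\<not> ?thesis"
      \<comment> \<open>On a path that is not hit, absence from \<open>L\<close> propagates: the
        edge out of \<open>x i\<close> forces the next vertex into \<open>R\<close>, and an inner
        vertex in both \<open>L\<close> and \<open>R\<close> would lie in \<open>X2\<close>.\<close>
      have "x i \<notin> L" if "Suc i < k" for i
        using that
      proof (induction i)
        case 0
        then show ?case using no x by (auto simp: X0_def transversal_path_def)
      next
        case (Suc i)
        then have *: "x i < n" "x (Suc i) < n" "layer (x i) = i" "layer (x (Suc i)) = Suc i"
          "(x i, x (Suc i)) \<in> E" "x i \<notin> L"
          using x by (auto simp: transversal_path_def)
        then have "x (Suc i) \<in> R" using cover by (auto simp: split_adj_def)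
        moreover have "inner (x (Suc i))" using * Suc by (auto simp: inner_def)
        ultimately show ?case using no * Suc by (auto simp: X2_def)
      qed
      \<comment> \<open>The last edge of the path then puts its end into \<open>R\<close>, hence
        into \<open>X1\<close>.\<close>
      from this[of "k - 2"] have "x (k - 2) \<notin> L" using k by auto
      moreover have "x (k - 2) < n" "x (k - 1) < n" "layer (x (k - 2)) = k - 2"
          "layer (x (k - 1)) = k - 1" "(x (k - 2), x (k - 1)) \<in> E"
        using x k unfolding transversal_path_def
        by (auto dest!: spec[of _ "k - 2"] simp: Suc_diff_Suc numeral_2_eq_2)
      ultimately have "x (k - 1) \<in> X1"
        using cover k by (auto simp: split_adj_def X1_def)
      then show False using no k by auto
    qed
  qed
  moreover have "card (X0 \<union> X1 \<union> X2) + card ?I \<le> card L + card R"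
  proof -
    \<comment> \<open>The edge between the two copies of an inner vertex forces at least one of them
      into the cover; inclusion-exclusion then accounts for \<open>X2\<close>.\<close>
    have "card ?I \<le> card ((L \<inter> ?I) \<union> (R \<inter> ?I))"
      using cover by (intro card_mono) (auto simp: split_adj_def fin)
    then have "card ?I + card X2 \<le> card (L \<inter> ?I) + card (R \<inter> ?I)"
      using card_Un_Int[of "L \<inter> ?I" "R \<inter> ?I"] fin
      by (simp add: X2_def Int_ac)
    moreover have "card X0 + card (L \<inter> ?I) = card (X0 \<union> (L \<inter> ?I))"
      by (rule card_Un_disjoint[symmetric]) (auto simp: X0_def fin inner_def)
    moreover have "card (X0 \<union> (L \<inter> ?I)) \<le> card L"
      by (rule card_mono) (auto simp: X0_def fin)
    moreover have "card X1 + card (R \<inter> ?I) = card (X1 \<union> (R \<inter> ?I))"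
      by (rule card_Un_disjoint[symmetric]) (auto simp: X1_def fin inner_def)
    moreover have "card (X1 \<union> (R \<inter> ?I)) \<le> card R"
      by (rule card_mono) (auto simp: X1_def fin)
    moreover have "card (X0 \<union> X1 \<union> X2) \<le> card X0 + card X1 + card X2"
      by (meson card_Un_le add_le_mono1 le_trans)
    ultimately show ?thesis by linarith
  qed
  ultimately show ?thesis by blast
qed

section \<open>From hitting sets to vertex covers by reachability\<close>

inductive reach :: "nat set \<Rightarrow> nat \<Rightarrow> bool" for X where
  start: "v < n \<Longrightarrow> layer v = 0 \<Longrightarrow> v \<notin> X \<Longrightarrow> reach X v"
| step: "reach X u \<Longrightarrow> w < n \<Longrightarrow> (u, w) \<in> E \<Longrightarrow> layer w = Suc (layer u) \<Longrightarrow> w \<notin> X \<Longrightarrow> reach X w"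

lemma reach_notin: "reach X v \<Longrightarrow> v \<notin> X \<and> v < n"
  by (induction rule: reach.induct) auto

text \<open>Each step climbs exactly one layer, so the walk can be indexed by layers and is an
  initial piece of a transversal path.\<close>

lemma reach_path:
  "reach X v \<Longrightarrow> \<exists>x. x (layer v) = v \<and> (\<forall>i\<le>layer v. x i < n \<and> layer (x i) = i \<and> x i \<notin> X) \<and>
    (\<forall>i<layer v. (x i, x (Suc i)) \<in> E)"
proof (induction rule: reach.induct)
  case (start v)
  then show ?case by (intro exI[of _ "\<lambda>_. v"]) auto
next
  case (step u w)
  then obtain x where x: "x (layer u) = u"
    "\<forall>i\<le>layer u. x i < n \<and> layer (x i) = i \<and> x i \<notin> X" "\<forall>i<layer u. (x i, x (Suc i)) \<in> E"
    by blast
  then show ?case using step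
    by (intro exI[of _ "x(Suc (layer u) := w)"]) (auto simp: le_Suc_eq less_Suc_eq)
qed

text \<open>The reachable region is one side of a cut. An edge leaving it ends in \<open>X\<close>,
  an edge staying inside ends in a vertex covered on the right, and an edge starting outside starts
  in a vertex covered on the left.\<close>

lemma cover_of_hits:
  assumes hits: "hits_paths X"
  shows "\<exists>L R. finite L \<and> finite R \<and> (\<forall>i<n. \<forall>j<n. split_adj i j \<longrightarrow> i \<in> L \<or> j \<in> R) \<and>
    card L + card R = card X + card {v. v < n \<and> inner v}"
proof -
  let ?I = "{v. v < n \<and> inner v}"
  define X0 where "X0 = {v\<in>X. layer v = 0}"
  define X1 where "X1 = {v\<in>X. layer v = k - 1}"
  define X2 where "X2 = X \<inter> ?I"
  define I0 where "I0 = {v\<in>?I. \<not> reach X v}"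
  define I1 where "I1 = {v\<in>?I. reach X v}"
  have X: "X \<subseteq> {..<n}" using hits by (auto simp: hits_paths_def)
  then have fin: "finite X" using finite_subset by blast
  \<comment> \<open>Reaching the last layer would complete a transversal path that avoids
    \<open>X\<close>.\<close>
  have unreach: "\<not> reach X v" if "layer v = k - 1" for v
  proof
    assume "reach X v"
    from reach_path[OF this, unfolded that] obtain x
      where x: "\<forall>i\<le>k - 1. x i < n \<and> layer (x i) = i \<and> x i \<notin> X" "\<forall>i<k - 1. (x i, x (Suc i)) \<in> E"
      by blast
    then have "transversal_path x" unfolding transversal_path_def by auto
    then obtain i where "i < k" "x i \<in> X" using hits by (auto simp: hits_paths_def)
    then show False using x by auto
  qed
  have "i \<in> X0 \<union> I0 \<or> j \<in> X1 \<union> (I1 \<union> X2)" if ij: "i < n" "j < n" "split_adj i j" for i j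
  proof (cases "i = j \<and> inner i")
    case True
    then show ?thesis using ij by (auto simp: I0_def I1_def)
  next
    case False
    then have E: "(i, j) \<in> E" "layer j = Suc (layer i)" using ij by (auto simp: split_adj_def)
    show ?thesis
    proof (cases "reach X i")
      case True
      have "inner j \<or> layer j = k - 1" using layer_cases[OF ij(2)] E by auto
      moreover have "j \<in> X \<or> reach X j" using reach.step[OF True ij(2) E] by blast
      ultimately show ?thesis using unreach ij by (auto simp: X1_def I1_def X2_def)
    next
      case False
      have "layer i = 0 \<or> inner i" using layer[OF ij(2)] E by (auto simp: inner_def)
      then show ?thesis using False ij reach.start[of i X] by (auto simp: X0_def I0_def)
    qed
  qed
  moreover have "card (X0 \<union> I0) + card (X1 \<union> (I1 \<union> X2)) = card X + card ?I"
  proof -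
    have f: "finite X0" "finite X1" "finite X2" "finite I0" "finite I1"
      using fin by (auto simp: X0_def X1_def X2_def I0_def I1_def)
    have "card (X0 \<union> I0) = card X0 + card I0"
      using f by (intro card_Un_disjoint) (auto simp: X0_def I0_def inner_def)
    moreover have "card (X1 \<union> (I1 \<union> X2)) = card X1 + card (I1 \<union> X2)"
      using f by (intro card_Un_disjoint) (auto simp: X1_def I1_def X2_def inner_def)
    \<comment> \<open>Reachable vertices avoid \<open>X\<close>. Thus each inner vertex of
      \<open>X\<close> is counted in \<open>I0\<close> and again in \<open>X2\<close>, every other
      inner vertex just once.\<close>
    moreover have "card (I1 \<union> X2) = card I1 + card X2"
      using f reach_notin by (intro card_Un_disjoint) (auto simp: I1_def X2_def)
    moreover have "card ?I = card (I0 \<union> I1)"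
      by (rule arg_cong[where f = card]) (auto simp: I0_def I1_def)
    moreover have "card (I0 \<union> I1) = card I0 + card I1"
      using f by (intro card_Un_disjoint) (auto simp: I0_def I1_def)
    moreover have "card X = card (X0 \<union> (X1 \<union> X2))"
      using X layer_cases
      by (intro arg_cong[where f = card]) (unfold X0_def X1_def X2_def, blast)
    moreover have "card (X0 \<union> (X1 \<union> X2)) = card X0 + card (X1 \<union> X2)"
      using f k by (intro card_Un_disjoint) (auto simp: X0_def X1_def X2_def inner_def)
    moreover have "card (X1 \<union> X2) = card X1 + card X2"
      using f by (intro card_Un_disjoint) (auto simp: X1_def X2_def inner_def)
    ultimately show ?thesis by linarith
  qed
  moreover have "finite (X0 \<union> I0)" "finite (X1 \<union> (I1 \<union> X2))"
    using fin by (auto simp: X0_def X1_def X2_def I0_def I1_def)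
  ultimately show ?thesis
    by (intro exI[of _ "X0 \<union> I0"] exI[of _ "X1 \<union> (I1 \<union> X2)"] conjI allI impI)
qed

text \<open>The sold items bound every cover from below, and the cover read off the final prices is
  no larger, so both bounds are tight.\<close>

lemma auction_computes_hitting:
  assumes inv: "auction_inv split_adj n p own"
    and settled: "\<forall>i<n. auction_settled split_adj n p own i"
  shows "Min (card ` {X. hits_paths X}) =
    card {j. j < n \<and> p j \<noteq> 0} - card {v. v < n \<and> inner v}" (is "_ = ?m - ?c")
proof (rule Min_eqI)
  have "{X. hits_paths X} \<subseteq> Pow {..<n}" by (auto simp: hits_paths_def)
  then show "finite (card ` {X. hits_paths X})" by (simp add: finite_subset)
  have lower: "?m \<le> card X + ?c" if "hits_paths X" for X
    using cover_of_hits[OF that] auction_matching[OF inv] by metis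
  then show "?m - ?c \<le> y" if "y \<in> card ` {X. hits_paths X}" for y
    using that by force
  obtain L R where "L \<subseteq> {..<n}" "R \<subseteq> {..<n}" "\<forall>i<n. \<forall>j<n. split_adj i j \<longrightarrow> i \<in> L \<or> j \<in> R"
    and LR: "card L + card R \<le> ?m"
    using auction_cover[OF inv settled] by metis
  then obtain X where X: "hits_paths X" "card X + ?c \<le> card L + card R"
    using hits_of_cover by metis
  \<comment> \<open>Both bounds give \<open>card X + ?c = ?m\<close>, so the subtraction does not
    truncate.\<close>
  then have "card X = ?m - ?c" using lower[OF X(1)] LR by linarith
  then show "?m - ?c \<in> card ` {X. hits_paths X}" using X by force
qed

end

section \<open>Colorful paths\<close>

text \<open>Injectivity is automatic, because \<open>\<sigma>\<close> inverts \<open>\<pi>\<close>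
  on the colors; the backward arcs follow from the symmetry of \<open>G\<close>.\<close>

lemma colorful_path_iff:
  assumes "distinct vs" "pverts H = set vs"
    and arcs: "parcs H = {(vs ! i, vs ! Suc i) | i. Suc i < length vs} \<union>
                {(vs ! Suc i, vs ! i) | i. Suc i < length vs}"
    and G: "pair_graph G"
  shows "colorful_subgraph H G \<sigma> \<pi> \<longleftrightarrow>
    (\<forall>i<length vs. \<pi> (vs ! i) \<in> pverts G \<and> \<sigma> (\<pi> (vs ! i)) = vs ! i) \<and>
    (\<forall>i. Suc i < length vs \<longrightarrow> (\<pi> (vs ! i), \<pi> (vs ! Suc i)) \<in> parcs G)" (is "?l \<longleftrightarrow> ?r")
proof
  assume ?l
  then show ?r unfolding colorful_subgraph_def using assms(2) arcs by (auto simp: Pi_iff; blast)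
next
  assume r: ?r
  interpret pair_graph G by (rule G)
  have "(\<pi> a, \<pi> b) \<in> parcs G" if "(a, b) \<in> parcs H" for a b
    using r that sym_arcs unfolding arcs by (auto simp: symmetric_def dest: symD)
  moreover have col: "\<pi> a \<in> pverts G \<and> \<sigma> (\<pi> a) = a" if "a \<in> pverts H" for a
    using r that assms(2) by (metis in_set_conv_nth)
  moreover have "inj_on \<pi> (pverts H)" by (rule inj_on_inverseI[where g = \<sigma>]) (use col in blast)
  ultimately show ?l unfolding colorful_subgraph_def by auto
qed

text \<open>Each vertex on its own is a colorful copy of \<open>H\<close>, so only the full vertex
  set hits them all.\<close>

lemma hitting_number_single:
  assumes "pverts H = {a}" "parcs H = {}" "finite (pverts G)" "is_coloring H G \<sigma>"
  shows "hitting_number H G \<sigma> = card (pverts G)"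
proof -
  have "X = pverts G" if "hitting_set H G \<sigma> X" for X
  proof
    show "X \<subseteq> pverts G" using that by (auto simp: hitting_set_def)
    show "pverts G \<subseteq> X"
    proof
      fix v assume v: "v \<in> pverts G"
      then have "\<sigma> v = a" using assms by (auto simp: is_coloring_def)
      then have "colorful_subgraph H G \<sigma> (\<lambda>_. v)"
        using v assms by (auto simp: colorful_subgraph_def)
      then show "v \<in> X" using that assms by (auto simp: hitting_set_def)
    qed
  qed
  moreover have "hitting_set H G \<sigma> (pverts G)"
    using assms by (auto simp: hitting_set_def colorful_subgraph_def)
  ultimately have "{X. hitting_set H G \<sigma> X} = {pverts G}" by blast
  then show ?thesis by (simp add: hitting_number_def)
qed

lemma hitting_number_layered:
  assumes vs: "distinct vs" "pverts H = set vs"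
    and arcs: "parcs H = {(vs ! i, vs ! Suc i) | i. Suc i < length vs} \<union>
                {(vs ! Suc i, vs ! i) | i. Suc i < length vs}"
    and G: "pair_graph G" "pverts G = {0..<n}"
    and color: "\<And>v. v < n \<Longrightarrow> layer v < length vs \<and> vs ! layer v = \<sigma> v"
    and lg: "layered_graph n (length vs) layer"
  shows "hitting_number H G \<sigma> =
    Min (card ` {X. layered_graph.hits_paths n (length vs) (parcs G) layer X})"
proof -
  interpret layered_graph n "length vs" "parcs G" layer by (rule lg)
  have layer_eq: "layer v = i \<longleftrightarrow> \<sigma> v = vs ! i" if "v < n" "i < length vs" for v i
    using color[OF that(1)] nth_eq_iff_index_eq[OF vs(1), of "layer v" i] that(2) by metis
  have colorful: "colorful_subgraph H G \<sigma> \<pi> \<longleftrightarrow> transversal_path (\<lambda>i. \<pi> (vs ! i))" for \<pi>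
    unfolding colorful_path_iff[OF vs arcs G(1)] transversal_path_def G(2)
    using layer_eq by auto
  have "hitting_set H G \<sigma> X \<longleftrightarrow> hits_paths X" for X
  proof
    assume h: "hitting_set H G \<sigma> X"
    show "hits_paths X" unfolding hits_paths_def
    proof (intro conjI allI impI)
      show "X \<subseteq> {..<n}" using h G by (auto simp: hitting_set_def)
      fix x assume x: "transversal_path x"
      \<comment> \<open>A color is sent to the path vertex at the position of that color in
        \<open>vs\<close>, which is unique by distinctness.\<close>
      define \<pi> where "\<pi> a = x (inv_into {..<length vs} ((!) vs) a)" for a
      have inj: "inj_on ((!) vs) {..<length vs}" using vs(1) by (auto intro: inj_on_nth)
      have \<pi>: "\<pi> (vs ! i) = x i" if "i < length vs" for i
        unfolding \<pi>_def using inv_into_f_f[OF inj, of i] that by simp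
      have "transversal_path (\<lambda>i. \<pi> (vs ! i))"
        using x \<pi> by (auto simp: transversal_path_def)
      then have "X \<inter> \<pi> ` pverts H \<noteq> {}" using h colorful by (auto simp: hitting_set_def)
      then obtain a where "a \<in> set vs" "\<pi> a \<in> X" using vs by auto
      then show "\<exists>i<length vs. x i \<in> X" using \<pi> by (metis in_set_conv_nth)
    qed
  next
    assume h: "hits_paths X"
    show "hitting_set H G \<sigma> X" unfolding hitting_set_def
    proof (intro conjI allI impI)
      show "X \<subseteq> pverts G" using h G by (auto simp: hits_paths_def)
      fix \<pi> assume "colorful_subgraph H G \<sigma> \<pi>"
      then obtain i where "i < length vs" "\<pi> (vs ! i) \<in> X"
        using h colorful by (auto simp: hits_paths_def)
      then show "X \<inter> \<pi> ` pverts H \<noteq> {}" using vs by auto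
    qed
  qed
  then show ?thesis by (simp add: hitting_number_def)
qed

section \<open>Total correctness with time bounds\<close>

text \<open>Bounding the time from above lets branches of different cost share one bound. The
  postcondition may itself be a \<open>runs\<close> statement, which is how sequences are
  chained.\<close>

definition runs :: "com \<Rightarrow> state \<Rightarrow> nat \<Rightarrow> (state \<Rightarrow> bool) \<Rightarrow> bool" where
  "runs c s T Q \<longleftrightarrow> (\<exists>t s'. exec c s t s' \<and> t \<le> T \<and> Q s')"

lemma runs_mono:
  assumes "runs c s T Q" "T \<le> T'" "\<And>s. Q s \<Longrightarrow> Q' s"
  shows "runs c s T' Q'"
  using assms unfolding runs_def by (meson le_trans)

lemma runs_Seq:
  assumes "runs c s T (\<lambda>s'. runs d s' U Q)"
  shows "runs (Seq c d) s (T + U) Q"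
  using assms unfolding runs_def by (meson exec.Seq add_mono)

lemma runs_Cond:
  assumes "val e s \<noteq> 0 \<Longrightarrow> runs c s T Q" "val e s = 0 \<Longrightarrow> runs d s T Q"
  shows "runs (Cond e c d) s (1 + cost e + T) Q"
proof (cases "val e s = 0")
  case True
  then obtain t s' where "exec d s t s'" "t \<le> T" "Q s'" using assms by (auto simp: runs_def)
  then show ?thesis unfolding runs_def
    by (intro exI[of _ "1 + cost e + t"] exI[of _ s']) (use exec.CondFalse[OF True] in auto)
next
  case False
  then obtain t s' where "exec c s t s'" "t \<le> T" "Q s'" using assms by (auto simp: runs_def)
  then show ?thesis unfolding runs_def
    by (intro exI[of _ "1 + cost e + t"] exI[of _ s']) (use exec.CondTrue[OF False] in auto)
qed

text \<open>\<open>f\<close> is a variant: there are at most \<open>f s\<close> iterations, and the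
  extra summand 1 pays for the final test.\<close>

lemma runs_While:
  assumes "I s"
    and body: "\<And>s. I s \<Longrightarrow> val e s \<noteq> 0 \<Longrightarrow> runs c s T (\<lambda>s'. I s' \<and> f s' < f s)"
    and exit: "\<And>s. I s \<Longrightarrow> val e s = 0 \<Longrightarrow> Q s"
  shows "runs (While e c) s ((f s + 1) * (1 + cost e + T)) Q"
  using \<open>I s\<close>
proof (induction "f s" arbitrary: s rule: less_induct)
  case less
  show ?case
  proof (cases "val e s = 0")
    case True
    then show ?thesis using exit[OF less(2)] unfolding runs_def
      by (intro exI[of _ "1 + cost e"] exI[of _ s]) (simp add: exec.WhileFalse[simplified])
  next
    case False
    obtain t s' where s': "exec c s t s'" "t \<le> T" "I s'" "f s' < f s"
      using body[OF less(2) False] by (auto simp: runs_def)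
    obtain u s'' where s'': "exec (While e c) s' u s''" "u \<le> (f s' + 1) * (1 + cost e + T)" "Q s''"
      using less(1)[OF s'(4,3)] by (auto simp: runs_def)
    have "(f s' + 1) * (1 + cost e + T) \<le> f s * (1 + cost e + T)"
      using s'(4) by (intro mult_right_mono) auto
    then have "1 + cost e + t + u \<le> (f s + 1) * (1 + cost e + T)"
      using s'(2) s''(2) by (simp add: algebra_simps)
    then show ?thesis using exec.WhileTrue[OF False s'(1) s''(1)] s''(3) unfolding runs_def by blast
  qed
qed

section \<open>Symbolic execution of loop-free code\<close>

fun loop_free :: "com \<Rightarrow> bool" where
  "loop_free Skip = True"
| "loop_free (Assign i e) = True"
| "loop_free (Store e f) = True"
| "loop_free (Seq c d) = (loop_free c \<and> loop_free d)"
| "loop_free (Cond e c d) = (loop_free c \<and> loop_free d)"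
| "loop_free (While e c) = False"

text \<open>In these two functions the clauses for loops are junk.\<close>

fun result :: "com \<Rightarrow> state \<Rightarrow> state" where
  "result Skip s = s"
| "result (Assign i e) s = ((fst s)(i := val e s), snd s)"
| "result (Store e f) s = (fst s, (snd s)(val e s := val f s))"
| "result (Seq c d) s = result d (result c s)"
| "result (Cond e c d) s = (if val e s = 0 then result d s else result c s)"
| "result (While e c) s = s"

fun max_time :: "com \<Rightarrow> nat" where
  "max_time Skip = 1"
| "max_time (Assign i e) = 1 + cost e"
| "max_time (Store e f) = 1 + cost e + cost f"
| "max_time (Seq c d) = max_time c + max_time d"
| "max_time (Cond e c d) = 1 + cost e + (max_time c + max_time d)"
| "max_time (While e c) = 0"

text \<open>Loop-free code always halts, so \<open>result\<close> evaluates it by rewriting. A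
  conditional is charged for both branches, which makes the bound independent of the state.\<close>

lemma runs_loop_free:
  assumes "loop_free c" "Q (result c s)"
  shows "runs c s (max_time c) Q"
  using assms
proof (induction c arbitrary: s Q)
  case Skip
  then show ?case using exec.Skip[of s]
    unfolding runs_def by (intro exI[of _ 1] exI[of _ s]) simp
next
  case (Assign i e)
  then show ?case using exec.Assign[of i e "fst s" "snd s"]
    unfolding runs_def by (intro exI[of _ "max_time (Assign i e)"] exI[of _ "result (Assign i e) s"]) simp
next
  case (Store e f)
  then show ?case using exec.Store[of e f "fst s" "snd s"]
    unfolding runs_def by (intro exI[of _ "max_time (Store e f)"] exI[of _ "result (Store e f) s"]) simp
next
  case (Seq c d)
  then show ?case by (simp add: runs_Seq)
next
  case (Cond e c d)
  have "runs (Cond e c d) s (1 + cost e + (max_time c + max_time d)) Q"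
  proof (rule runs_Cond)
    assume "val e s \<noteq> 0"
    then have "runs c s (max_time c) Q" using Cond by simp
    then show "runs c s (max_time c + max_time d) Q" by (rule runs_mono) auto
  next
    assume "val e s = 0"
    then have "runs d s (max_time d) Q" using Cond by simp
    then show "runs d s (max_time c + max_time d) Q" by (rule runs_mono) auto
  qed
  then show ?case by simp
qed auto

lemma runs_While_loop_free:
  assumes "I s" "loop_free c"
    and "\<And>s. I s \<Longrightarrow> val e s \<noteq> 0 \<Longrightarrow> I (result c s) \<and> f (result c s) < f s"
    and "\<And>s. I s \<Longrightarrow> val e s = 0 \<Longrightarrow> Q s"
  shows "runs (While e c) s ((f s + 1) * (1 + cost e + max_time c)) Q"
  by (rule runs_While[where I = I]) (use assms in \<open>auto intro: runs_loop_free\<close>)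

section \<open>The program\<close>

text \<open>With truncated subtraction the inner sum is the distance of the two values, so the
  result is the bit for equality.\<close>

definition eqE :: "exp \<Rightarrow> exp \<Rightarrow> exp" where
  "eqE a b = Sub (Const 1) (Add (Sub a b) (Sub b a))"

text \<open>Conjunction of two bits without multiplication.\<close>

definition bothE :: "exp \<Rightarrow> exp \<Rightarrow> exp" where
  "bothE a b = Sub (Add a b) (Const 1)"

text \<open>Serves as a finite disjunction, with nonzero read as true.\<close>

definition sumE :: "exp list \<Rightarrow> exp" where
  "sumE es = foldr Add es (Const 0)"

lemma val_eqE: "val (eqE a b) s = (if val a s = val b s then 1 else 0)"
  by (auto simp: eqE_def)

lemma val_bothE:
  "val a s \<le> 1 \<Longrightarrow> val b s \<le> 1 \<Longrightarrow> val (bothE a b) s = (if val a s \<noteq> 0 \<and> val b s \<noteq> 0 then 1 else 0)"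
  by (auto simp: bothE_def)

lemma val_sumE_eq_0: "val (sumE es) s = 0 \<longleftrightarrow> (\<forall>e\<in>set es. val e s = 0)"
  by (induction es) (auto simp: sumE_def)

text \<open>Register 1 holds \<open>n\<close>; registers 2, 3 and 4 hold the base addresses of the colors, the prices
  and the owners; registers 5 and 6 hold the current bidder \<open>i\<close> and item \<open>j\<close>; register 7 holds the
  base address of row \<open>i\<close> of the adjacency matrix. Prices and owners are kept behind the input,
  where memory is initially zero.\<close>

definition layout :: "nat \<Rightarrow> (nat \<Rightarrow> nat) \<Rightarrow> (nat \<Rightarrow> nat) \<Rightarrow> (nat \<Rightarrow> nat) \<Rightarrow> bool" where
  "layout n inp R M \<longleftrightarrow> R 1 = n \<and> R 2 = 1 + n * n \<and> R 3 = 1 + n * n + n \<and>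
    R 4 = 1 + n * n + n + n \<and> (\<forall>a<1 + n * n + n. M a = inp a)"

definition price :: "nat \<Rightarrow> (nat \<Rightarrow> nat) \<Rightarrow> nat \<Rightarrow> nat" where
  "price n M j = M (1 + n * n + n + j)"

definition owner :: "nat \<Rightarrow> (nat \<Rightarrow> nat) \<Rightarrow> nat \<Rightarrow> nat" where
  "owner n M j = M (1 + n * n + n + n + j)"

definition incr :: "nat \<Rightarrow> com" where
  "incr i = Assign i (Add (Reg i) (Const 1))"

definition priceE :: "nat \<Rightarrow> exp" where
  "priceE i = Mem (Add (Reg 3) (Reg i))"

text \<open>Register 8 keeps the lowest neighbor price seen, register 9 an item attaining it, and
  register 10 flags that the bidder already owns an item. The flag has the value
  \<open>n + 2\<close> so that subtracting it in the guard of \<open>bid\<close> always gives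
  0.\<close>

definition scan_body :: "exp \<Rightarrow> com" where
  "scan_body A =
    Seq (Cond A (Cond (Sub (Reg 8) (priceE 6)) (Seq (Assign 8 (priceE 6)) (Assign 9 (Reg 6))) Skip)
          Skip)
   (Seq (Cond (eqE (Mem (Add (Reg 4) (Reg 6))) (Add (Reg 5) (Const 1)))
          (Assign 10 (Add (Reg 1) (Const 2))) Skip)
        (incr 6))"

definition scan_init :: com where
  "scan_init = Seq (Assign 6 (Const 0)) (Seq (Assign 8 (Add (Reg 1) (Const 2))) (Assign 10 (Const 0)))"

definition scan :: "exp \<Rightarrow> com" where
  "scan A = While (Sub (Reg 1) (Reg 6)) (scan_body A)"

text \<open>After a bid the search for an unsettled bidder restarts at 0.\<close>

definition bid :: com where
  "bid = Cond (Sub (Sub (Add (Reg 1) (Const 2)) (Reg 8)) (Reg 10))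
    (Seq (Store (Add (Reg 3) (Reg 9)) (Add (priceE 9) (Const 1)))
    (Seq (Store (Add (Reg 4) (Reg 9)) (Add (Reg 5) (Const 1)))
    (Seq (Assign 5 (Const 0)) (Assign 7 (Const 1)))))
    (Seq (incr 5) (Assign 7 (Add (Reg 7) (Reg 1))))"

definition auction :: "exp \<Rightarrow> com" where
  "auction A = While (Sub (Reg 1) (Reg 5)) (Seq scan_init (Seq (scan A) bid))"

definition count_body :: "exp \<Rightarrow> com" where
  "count_body B =
    Seq (Cond (priceE 6) (incr 11) Skip) (Seq (Cond B (incr 12) Skip) (incr 6))"

definition count :: "exp \<Rightarrow> com" where
  "count B = While (Sub (Reg 1) (Reg 6)) (count_body B)"

definition count_init :: com where
  "count_init = Seq (Assign 6 (Const 0)) (Seq (Assign 11 (Const 0)) (Assign 12 (Const 0)))"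

text \<open>The machine cannot multiply, so \<open>n * n\<close> is obtained by \<open>n\<close>
  additions.\<close>

definition square_body :: com where
  "square_body = Seq (Assign 2 (Add (Reg 2) (Reg 1))) (incr 5)"

definition square :: com where
  "square = While (Sub (Reg 1) (Reg 5)) square_body"

definition square_init :: com where
  "square_init = Seq (Assign 1 (Mem (Const 0))) (Assign 2 (Const 1))"

definition auction_init :: com where
  "auction_init = Seq (Assign 3 (Add (Reg 2) (Reg 1))) (Seq (Assign 4 (Add (Reg 3) (Reg 1)))
    (Seq (Assign 5 (Const 0)) (Assign 7 (Const 1))))"

definition finish :: com where
  "finish = Assign 0 (Sub (Reg 11) (Reg 12))"

text \<open>\<open>A\<close> tests adjacency in the split graph and \<open>B\<close> tests for inner
  vertices; only these two expressions depend on \<open>H\<close>.\<close>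

definition program :: "exp \<Rightarrow> exp \<Rightarrow> com" where
  "program A B = Seq square_init (Seq square (Seq auction_init (Seq (auction A)
    (Seq count_init (Seq (count B) finish)))))"

section \<open>Correctness and running time of the loops\<close>

lemma runs_scan:
  assumes A: "\<And>R j. layout n inp R M \<Longrightarrow> R 5 = i \<Longrightarrow> R 6 = j \<Longrightarrow> j < n \<Longrightarrow> R 7 = 1 + i * n \<Longrightarrow>
      val A (R, M) \<noteq> 0 \<longleftrightarrow> adj i j"
    and "layout n inp R M" "R 5 = i" "R 7 = 1 + i * n" "R 6 = 0" "R 8 = n + 2" "R 10 = 0"
  shows "runs (scan A) (R, M) ((n + 1) * (4 + max_time (scan_body A))) (\<lambda>(R', M'). M' = M \<and>
    layout n inp R' M \<and> R' 5 = i \<and> R' 7 = 1 + i * n \<and> R' 8 \<le> n + 2 \<and>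
    (\<forall>j<n. adj i j \<longrightarrow> R' 8 \<le> price n M j) \<and>
    (R' 8 < n + 2 \<longrightarrow> R' 9 < n \<and> adj i (R' 9) \<and> price n M (R' 9) = R' 8) \<and>
    R' 10 = (if \<exists>j<n. owner n M j = Suc i then n + 2 else 0))" (is "runs _ _ _ ?Q")
proof -
  \<comment> \<open>The postcondition restricted to the items below register 6. Register 9 is
    meaningful only once register 8 has dropped below its initial value, the cap
    \<open>n + 2\<close>.\<close>
  define I where "I = (\<lambda>(R', M'). M' = M \<and>
    layout n inp R' M \<and> R' 5 = i \<and> R' 7 = 1 + i * n \<and> R' 6 \<le> n \<and> R' 8 \<le> n + 2 \<and>
    (\<forall>j<R' 6. adj i j \<longrightarrow> R' 8 \<le> price n M j) \<and>
    (R' 8 < n + 2 \<longrightarrow> R' 9 < n \<and> adj i (R' 9) \<and> price n M (R' 9) = R' 8) \<and>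
    R' 10 = (if \<exists>j<R' 6. owner n M j = Suc i then n + 2 else 0))"
  have "runs (While (Sub (Reg 1) (Reg 6)) (scan_body A)) (R, M)
    (((\<lambda>s. n - fst s 6) (R, M) + 1) * (1 + cost (Sub (Reg 1) (Reg 6)) + max_time (scan_body A))) ?Q"
  proof (rule runs_While_loop_free[where I = I])
    show "I (R, M)" using assms(2-) by (auto simp: I_def)
    show "loop_free (scan_body A)" by (simp add: scan_body_def incr_def)
  next
    fix s assume "I s" "val (Sub (Reg 1) (Reg 6)) s \<noteq> 0"
    moreover obtain R' M' where s: "s = (R', M')" by fastforce
    ultimately have I: "I (R', M)" "M' = M" and less: "R' 6 < n"
      by (auto simp: I_def layout_def)
    have L: "layout n inp R' M" using I by (simp add: I_def)
    have adj: "val A (R', M) = 0 \<longleftrightarrow> \<not> adj i (R' 6)"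
      using A[OF L _ refl less] I by (auto simp: I_def)
    have p: "val (priceE 6) (R', M) = price n M (R' 6)"
      using L by (simp add: priceE_def price_def layout_def)
    have o: "val (Mem (Add (Reg 4) (Reg 6))) (R'', M) = owner n M (R' 6)"
      if "R'' 4 = R' 4" "R'' 6 = R' 6" for R''
      using L that by (simp add: owner_def layout_def)
    let ?better = "adj i (R' 6) \<and> price n M (R' 6) < R' 8"
    let ?own = "owner n M (R' 6) = Suc i"
    define R1 where "R1 = (if ?better then R'(8 := price n M (R' 6), 9 := R' 6) else R')"
    define R2 where "R2 = (if ?own then R1(10 := n + 2) else R1)"
    have R1: "R1 8 = (if ?better then price n M (R' 6) else R' 8)"
      "R1 9 = (if ?better then R' 6 else R' 9)" "k \<noteq> 8 \<Longrightarrow> k \<noteq> 9 \<Longrightarrow> R1 k = R' k" for k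
      by (simp_all add: R1_def)
    have R2: "R2 10 = (if ?own then n + 2 else R' 10)" "k \<noteq> 10 \<Longrightarrow> R2 k = R1 k" for k
      by (simp_all add: R2_def R1)
    have res: "result (scan_body A) s = (R2(6 := Suc (R' 6)), M)"
    proof -
      have "result (Cond A (Cond (Sub (Reg 8) (priceE 6)) (Seq (Assign 8 (priceE 6))
          (Assign 9 (Reg 6))) Skip) Skip) s = (R1, M)"
        unfolding s I(2) R1_def by (simp add: adj p)
      moreover have "result (Cond (eqE (Mem (Add (Reg 4) (Reg 6))) (Add (Reg 5) (Const 1)))
          (Assign 10 (Add (Reg 1) (Const 2))) Skip) (R1, M) = (R2, M)"
        using o[of R1] L I(1) R1(3) by (simp add: val_eqE R2_def I_def layout_def del: val.simps(3))
      moreover have "result (incr 6) (R2, M) = (R2(6 := Suc (R' 6)), M)"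
        by (simp add: incr_def R2 R1)
      ultimately show ?thesis unfolding scan_body_def by simp
    qed
    have "layout n inp (R2(6 := Suc (R' 6))) M" using L by (simp add: layout_def R2 R1)
    moreover have "\<forall>j<Suc (R' 6). adj i j \<longrightarrow> R1 8 \<le> price n M j"
    proof (intro allI impI)
      fix j assume "j < Suc (R' 6)" "adj i j"
      then have "j < R' 6 \<or> j = R' 6" by auto
      moreover have "R' 8 \<le> price n M j" if "j < R' 6"
        using I(1) that \<open>adj i j\<close> by (simp add: I_def)
      ultimately show "R1 8 \<le> price n M j" using R1(1) \<open>adj i j\<close> by auto
    qed
    moreover have "R1 8 \<le> n + 2" "R1 8 < n + 2 \<longrightarrow> R1 9 < n \<and> adj i (R1 9) \<and> price n M (R1 9) = R1 8"
      using I(1) less R1 by (auto simp: I_def)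
    moreover have "R2 10 = (if \<exists>j<Suc (R' 6). owner n M j = Suc i then n + 2 else 0)"
      using I(1) R2(1) by (auto simp: I_def less_Suc_eq)
    moreover have "R' 5 = i" "R' 7 = 1 + i * n" using I(1) by (simp_all add: I_def)
    ultimately show "I (result (scan_body A) s) \<and>
        n - fst (result (scan_body A) s) 6 < n - fst s 6"
      unfolding res unfolding I_def s using less by (simp add: R2(2) R1(3))
  next
    fix s assume "I s" "val (Sub (Reg 1) (Reg 6)) s = 0"
    moreover obtain R' M' where s: "s = (R', M')" by fastforce
    ultimately have "R' 6 = n" by (auto simp: I_def layout_def)
    then show "?Q s" using \<open>I s\<close> by (auto simp: s I_def)
  qed
  \<comment> \<open>The 4 in the bound is the cost of one loop test.\<close>
  then show ?thesis unfolding scan_def by (rule runs_mono) (simp_all add: assms(6) algebra_simps)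
qed

lemma runs_square:
  assumes "R 1 = n" "R 2 = 1" "R 5 = 0"
    and Q: "\<And>R. R 1 = n \<Longrightarrow> R 2 = 1 + n * n \<Longrightarrow> Q (R, M)"
  shows "runs square (R, M) ((n + 1) * (4 + max_time square_body)) Q"
proof -
  define I :: "state \<Rightarrow> bool" where "I = (\<lambda>(R', M'). M' = M \<and> R' 1 = n \<and> R' 5 \<le> n \<and> R' 2 = 1 + R' 5 * n)"
  have "runs (While (Sub (Reg 1) (Reg 5)) square_body) (R, M)
    (((\<lambda>s. n - fst s 5) (R, M) + 1) * (1 + cost (Sub (Reg 1) (Reg 5)) + max_time square_body)) Q"
  proof (rule runs_While_loop_free[where I = I])
    show "I (R, M)" using assms by (simp add: I_def)
    show "loop_free square_body" by (simp add: square_body_def incr_def)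
  next
    fix s assume "I s" "val (Sub (Reg 1) (Reg 5)) s \<noteq> 0"
    then show "I (result square_body s) \<and> n - fst (result square_body s) 5 < n - fst s 5"
      by (cases s) (auto simp: I_def square_body_def incr_def)
  next
    fix s assume "I s" "val (Sub (Reg 1) (Reg 5)) s = 0"
    then show "Q s" using Q by (cases s) (auto simp: I_def)
  qed
  then show ?thesis unfolding square_def by (rule runs_mono) (simp_all add: assms(3) algebra_simps)
qed

lemma runs_count:
  assumes B: "\<And>R j. layout n inp R M \<Longrightarrow> R 6 = j \<Longrightarrow> j < n \<Longrightarrow> val B (R, M) \<noteq> 0 \<longleftrightarrow> inn j"
    and "layout n inp R M" "R 6 = 0" "R 11 = 0" "R 12 = 0"
    and Q: "\<And>R. R 11 = card {j. j < n \<and> price n M j \<noteq> 0} \<Longrightarrow> R 12 = card {j. j < n \<and> inn j} \<Longrightarrow> Q (R, M)"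
  shows "runs (count B) (R, M) ((n + 1) * (4 + max_time (count_body B))) Q"
proof -
  define I :: "state \<Rightarrow> bool" where "I = (\<lambda>(R', M'). M' = M \<and> layout n inp R' M \<and> R' 6 \<le> n \<and>
    R' 11 = card {j. j < R' 6 \<and> price n M j \<noteq> 0} \<and> R' 12 = card {j. j < R' 6 \<and> inn j})"
  have "runs (While (Sub (Reg 1) (Reg 6)) (count_body B)) (R, M)
    (((\<lambda>s. n - fst s 6) (R, M) + 1) * (1 + cost (Sub (Reg 1) (Reg 6)) + max_time (count_body B))) Q"
  proof (rule runs_While_loop_free[where I = I])
    show "I (R, M)" using assms by (simp add: I_def)
    show "loop_free (count_body B)" by (simp add: count_body_def incr_def)
  next
    fix s assume "I s" "val (Sub (Reg 1) (Reg 6)) s \<noteq> 0"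
    moreover obtain R' M' where s: "s = (R', M')" by fastforce
    ultimately have I: "I (R', M)" "M' = M" and less: "R' 6 < n"
      by (auto simp: I_def layout_def)
    have L: "layout n inp R' M" using I by (simp add: I_def)
    have card_Suc: "card {j. j < Suc m \<and> P j} = card {j. j < m \<and> P j} + (if P m then 1 else 0)"
      for m and P :: "nat \<Rightarrow> bool"
    proof -
      have "{j. j < Suc m \<and> P j} = (if P m then insert m {j. j < m \<and> P j} else {j. j < m \<and> P j})"
        by (auto simp: less_Suc_eq)
      then show ?thesis by simp
    qed
    define R1 where "R1 = (if price n M (R' 6) \<noteq> 0 then R'(11 := Suc (R' 11)) else R')"
    define R2 where "R2 = (if inn (R' 6) then R1(12 := Suc (R' 12)) else R1)"
    have "layout n inp R1 M" using L by (simp add: R1_def layout_def)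
    moreover have "R1 6 = R' 6" by (simp add: R1_def)
    ultimately have "val B (R1, M) = 0 \<longleftrightarrow> \<not> inn (R' 6)" using B[of R1 "R' 6"] less by blast
    then have "result (Cond B (incr 12) Skip) (R1, M) = (R2, M)"
      by (simp add: incr_def R2_def R1_def)
    moreover have "result (incr 6) (R2, M) = (R2(6 := Suc (R' 6)), M)"
      by (simp add: incr_def R2_def R1_def)
    moreover have "result (Cond (priceE 6) (incr 11) Skip) s = (R1, M)"
      using L unfolding s I(2) by (simp add: priceE_def incr_def R1_def price_def layout_def)
    ultimately have res: "result (count_body B) s = (R2(6 := Suc (R' 6)), M)"
      unfolding count_body_def by (simp only: result.simps(4))
    show "I (result (count_body B) s) \<and> n - fst (result (count_body B) s) 6 < n - fst s 6"
      unfolding res unfolding s using I(1) less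
      by (simp add: I_def R1_def R2_def layout_def card_Suc diff_less_mono2)
  next
    fix s assume "I s" "val (Sub (Reg 1) (Reg 6)) s = 0"
    then show "Q s" using Q by (cases s) (auto simp: I_def layout_def)
  qed
  then show ?thesis unfolding count_def by (rule runs_mono) (simp_all add: assms(3) algebra_simps)
qed

text \<open>Every bid raises the sum of the prices, which is at most \<open>n * (n + 2)\<close>, and between two bids
  the index of the current bidder grows.\<close>

lemma runs_auction:
  assumes A: "\<And>R M i j. layout n inp R M \<Longrightarrow> R 5 = i \<Longrightarrow> R 6 = j \<Longrightarrow> i < n \<Longrightarrow> j < n \<Longrightarrow>
      R 7 = 1 + i * n \<Longrightarrow> val A (R, M) \<noteq> 0 \<longleftrightarrow> adj i j"
    and "layout n inp R M" "R 5 = 0" "R 7 = 1" "\<And>a. 1 + n * n + n \<le> a \<Longrightarrow> M a = 0"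
    and Q: "\<And>R M. layout n inp R M \<Longrightarrow> auction_inv adj n (price n M) (owner n M) \<Longrightarrow>
      \<forall>i<n. auction_settled adj n (price n M) (owner n M) i \<Longrightarrow> Q (R, M)"
  shows "runs (auction A) (R, M) ((n * (n + 2) * (n + 1) + n + 1) *
    (4 + (max_time scan_init + ((n + 1) * (4 + max_time (scan_body A)) + max_time bid)))) Q"
proof -
  define I :: "state \<Rightarrow> bool" where "I = (\<lambda>(R, M). layout n inp R M \<and> R 5 \<le> n \<and> R 7 = 1 + R 5 * n \<and>
    auction_inv adj n (price n M) (owner n M) \<and>
    (\<forall>i<R 5. auction_settled adj n (price n M) (owner n M) i))"
  \<comment> \<open>A lexicographic measure in one number: the weight \<open>n + 1\<close> exceeds
    every value of \<open>n - R 5\<close>, so a bid lowers \<open>f\<close> although it resets the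
    bidder.\<close>
  define f :: "state \<Rightarrow> nat" where "f = (\<lambda>(R, M). (n * (n + 2) - (\<Sum>j<n. price n M j)) * (n + 1) + (n - R 5))"
  let ?body = "Seq scan_init (Seq (scan A) bid)"
  let ?T = "max_time scan_init + ((n + 1) * (4 + max_time (scan_body A)) + max_time bid)"
  have "runs (While (Sub (Reg 1) (Reg 5)) ?body) (R, M)
    ((f (R, M) + 1) * (1 + cost (Sub (Reg 1) (Reg 5)) + ?T)) Q"
  proof (rule runs_While[where I = I])
    show "I (R, M)" using assms(2-5) by (simp add: I_def auction_inv_def price_def owner_def)
  next
    fix s assume "I s" "val (Sub (Reg 1) (Reg 5)) s = 0"
    then show "Q s" using Q by (cases s) (auto simp: I_def layout_def)
  next
    fix s assume "I s" "val (Sub (Reg 1) (Reg 5)) s \<noteq> 0"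
    moreover obtain R M where s: "s = (R, M)" by fastforce
    ultimately have I: "I (R, M)" and i: "R 5 < n" by (auto simp: I_def layout_def)
    define i where "i = R 5"
    have inv: "auction_inv adj n (price n M) (owner n M)" using I by (simp add: I_def)
    have L: "layout n inp R M" and 7: "R 7 = 1 + i * n" using I by (simp_all add: I_def i_def)
    show "runs ?body s ?T (\<lambda>s'. I s' \<and> f s' < f s)"
    proof (intro runs_Seq runs_loop_free)
      show "loop_free scan_init" by (simp add: scan_init_def)
      define R0 where "R0 = R(6 := 0, 8 := n + 2, 10 := 0)"
      have init: "result scan_init s = (R0, M)"
        using L unfolding s R0_def by (simp add: scan_init_def layout_def)
      have "runs (scan A) (R0, M) ((n + 1) * (4 + max_time (scan_body A))) (\<lambda>(R', M'). M' = M \<and>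
        layout n inp R' M \<and> R' 5 = i \<and> R' 7 = 1 + i * n \<and> R' 8 \<le> n + 2 \<and>
        (\<forall>j<n. adj i j \<longrightarrow> R' 8 \<le> price n M j) \<and>
        (R' 8 < n + 2 \<longrightarrow> R' 9 < n \<and> adj i (R' 9) \<and> price n M (R' 9) = R' 8) \<and>
        R' 10 = (if \<exists>j<n. owner n M j = Suc i then n + 2 else 0))"
      proof (rule runs_scan)
        show "val A (R, M) \<noteq> 0 \<longleftrightarrow> adj i j" if "layout n inp R M" "R 5 = i" "R 6 = j" "j < n"
          "R 7 = 1 + i * n" for R j
          using A[OF that(1-3) _ that(4,5)] i by (simp add: i_def)
      qed (use L 7 in \<open>simp_all add: R0_def layout_def i_def\<close>)
      then show "runs (scan A) (result scan_init s) ((n + 1) * (4 + max_time (scan_body A)))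
        (\<lambda>s'. runs bid s' (max_time bid) (\<lambda>s'. I s' \<and> f s' < f s))"
        unfolding init
      proof (rule runs_mono)
        fix s' assume "case s' of (R', M') \<Rightarrow> M' = M \<and>
          layout n inp R' M \<and> R' 5 = i \<and> R' 7 = 1 + i * n \<and> R' 8 \<le> n + 2 \<and>
          (\<forall>j<n. adj i j \<longrightarrow> R' 8 \<le> price n M j) \<and>
          (R' 8 < n + 2 \<longrightarrow> R' 9 < n \<and> adj i (R' 9) \<and> price n M (R' 9) = R' 8) \<and>
          R' 10 = (if \<exists>j<n. owner n M j = Suc i then n + 2 else 0)"
        then obtain R' where s': "s' = (R', M)" and L': "layout n inp R' M" "R' 5 = i" "R' 7 = 1 + i * n"
          and le: "R' 8 \<le> n + 2" and min: "\<And>j. j < n \<Longrightarrow> adj i j \<Longrightarrow> R' 8 \<le> price n M j"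
          and b: "R' 8 < n + 2 \<Longrightarrow> R' 9 < n \<and> adj i (R' 9) \<and> price n M (R' 9) = R' 8"
          and own: "R' 10 = (if \<exists>j<n. owner n M j = Suc i then n + 2 else 0)"
          by (cases s') blast
        have R1: "R' 1 = n" using L' by (simp add: layout_def)
        show "runs bid s' (max_time bid) (\<lambda>s'. I s' \<and> f s' < f s)"
        proof (rule runs_loop_free)
          show "loop_free bid" by (simp add: bid_def incr_def)
          show "I (result bid s') \<and> f (result bid s') < f s"
          \<comment> \<open>The condition fails exactly if all neighbors are at the cap or the
            bidder already owns an item, that is, if the bidder is settled.\<close>
          proof (cases "R' 8 < n + 2 \<and> R' 10 = 0")
            case False
            then have "auction_settled adj n (price n M) (owner n M) i"
              using own min le unfolding auction_settled_def by (metis le_antisym not_less)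
            then have "I (R'(5 := Suc i, 7 := R' 7 + n), M)"
              using I L' inv i unfolding I_def by (auto simp: layout_def i_def less_Suc_eq)
            moreover have "result bid s' = (R'(5 := Suc i, 7 := R' 7 + n), M)"
              using False own le R1 L'(2) unfolding s' bid_def by (auto simp: incr_def split: if_splits)
            moreover have "f (R'(5 := Suc i, 7 := R' 7 + n), M) < f s"
              using i by (simp add: f_def s i_def)
            ultimately show ?thesis by simp
          next
            case True
            define b where "b = R' 9"
            have b: "b < n" "adj i b" "price n M b = R' 8" using b True by (auto simp: b_def)
            define M' where "M' = M(1 + n * n + n + b := price n M b + 1, 1 + n * n + n + n + b := Suc i)"
            \<comment> \<open>The displaced owner may be any earlier bidder; restarting at 0 makes
              the claim about settled bidders vacuous.\<close>
            have res: "result bid s' = (R'(5 := 0, 7 := 1), M')"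
              using True L' unfolding s' bid_def M'_def
              by (simp add: layout_def priceE_def price_def b_def)
            have p': "price n M' j = (if j = b then Suc (price n M b) else price n M j)"
              and o': "owner n M' j = (if j = b then Suc i else owner n M j)" if "j < n" for j
              using that b(1) by (auto simp: price_def owner_def M'_def)
            have inv': "auction_inv adj n (price n M') (owner n M')"
            proof (rule auction_inv_bid[OF inv])
              show "i < n" using i by (simp add: i_def)
              show "\<forall>j<n. owner n M j \<noteq> Suc i" using True own by (metis Zero_not_Suc add_2_eq_Suc')
              show "\<forall>j<n. adj i j \<longrightarrow> price n M b \<le> price n M j" using min b(3) by simp
            qed (use b True p' o' in auto)
            have L'': "layout n inp (R'(5 := 0, 7 := 1)) M'"
              using L' by (simp add: layout_def M'_def)
            have sum_le: "(\<Sum>j<n. price n M' j) \<le> n * (n + 2)"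
              using sum_bounded_above[of "{..<n}" "price n M'" "n + 2"] auction_inv_price_le[OF inv']
              by simp
            have "(\<Sum>j<n. price n M' j) = price n M' b + (\<Sum>j\<in>{..<n} - {b}. price n M' j)"
              using b(1) by (intro sum.remove) auto
            also have "(\<Sum>j\<in>{..<n} - {b}. price n M' j) = (\<Sum>j\<in>{..<n} - {b}. price n M j)"
              by (rule sum.cong) (auto simp: p')
            also have "price n M' b + \<dots> = Suc (\<Sum>j<n. price n M j)"
              using sum.remove[of "{..<n}" b "price n M"] b(1) p' by simp
            finally have sum_Suc: "(\<Sum>j<n. price n M' j) = Suc (\<Sum>j<n. price n M j)" .
            \<comment> \<open>Even after the bid the sum is within its bound, so the difference was
              positive before and truncation does no harm.\<close>
            obtain d where d: "n * (n + 2) - (\<Sum>j<n. price n M j) = Suc d"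
              "n * (n + 2) - (\<Sum>j<n. price n M' j) = d"
              using sum_le sum_Suc by (metis Suc_diff_le diff_Suc_Suc)
            have "f (R'(5 := 0, 7 := 1), M') = (n * (n + 2) - (\<Sum>j<n. price n M' j)) * (n + 1) + n"
              by (simp add: f_def)
            also have "\<dots> < Suc d * (n + 1)" unfolding d(2) by simp
            also have "\<dots> \<le> f s" unfolding f_def s prod.case d(1) by simp
            finally show ?thesis unfolding res using inv' L'' by (simp add: I_def)
          qed
        qed
      qed simp
    qed
  qed
  then show ?thesis unfolding auction_def
  proof (rule runs_mono)
    have "f (R, M) \<le> n * (n + 2) * (n + 1) + n"
      using diff_le_self[of "n * (n + 2)" "\<Sum>j<n. price n M j"]
      by (auto simp: f_def intro!: add_mono mult_right_mono simp del: add_2_eq_Suc')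
    then show "(f (R, M) + 1) * (1 + cost (Sub (Reg 1) (Reg 5)) + ?T) \<le>
        (n * (n + 2) * (n + 1) + n + 1) * (4 + ?T)"
      by (intro mult_mono) auto
  qed
qed

section \<open>Time bound and correctness of the whole program\<close>

text \<open>The nesting mirrors the sums produced by \<open>runs_Seq\<close>, so that the bound
  matches the program term by term.\<close>

definition time_poly :: "exp \<Rightarrow> exp \<Rightarrow> nat poly" where
  "time_poly A B = (let X = [:0, 1:]; c = (\<lambda>k. [:k:]) in
    c (max_time square_init) + ((X + 1) * c (4 + max_time square_body) + (c (max_time auction_init) +
    ((X * (X + 2) * (X + 1) + X + 1) *
      (4 + (c (max_time scan_init) + ((X + 1) * c (4 + max_time (scan_body A)) + c (max_time bid)))) +
    (c (max_time count_init) + ((X + 1) * c (4 + max_time (count_body B)) + c (max_time finish)))))))"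

lemma poly_time_poly:
  "poly (time_poly A B) n =
    max_time square_init + ((n + 1) * (4 + max_time square_body) + (max_time auction_init +
    ((n * (n + 2) * (n + 1) + n + 1) *
      (4 + (max_time scan_init + ((n + 1) * (4 + max_time (scan_body A)) + max_time bid))) +
    (max_time count_init + ((n + 1) * (4 + max_time (count_body B)) + max_time finish)))))"
proof -
  have 2: "poly 2 n = 2" and 4: "poly 4 n = 4" for n :: nat
    using poly_of_nat[of 2 n] poly_of_nat[of 4 n] by simp_all
  show ?thesis unfolding time_poly_def Let_def poly_add poly_mult 2 4 by simp
qed

lemma poly_nat_mono: "m \<le> n \<Longrightarrow> poly p m \<le> poly p n" for p :: "nat poly"
  by (induction p) (auto intro!: add_mono mult_mono)

lemma runs_program:
  assumes xs: "xs \<noteq> []" "xs ! 0 = n" "length xs = 1 + n * n + n"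
    and A: "\<And>R M i j. layout n ((!) xs) R M \<Longrightarrow> R 5 = i \<Longrightarrow> R 6 = j \<Longrightarrow> i < n \<Longrightarrow> j < n \<Longrightarrow>
      R 7 = 1 + i * n \<Longrightarrow> val A (R, M) \<noteq> 0 \<longleftrightarrow> adj i j"
    and B: "\<And>R M j. layout n ((!) xs) R M \<Longrightarrow> R 6 = j \<Longrightarrow> j < n \<Longrightarrow> val B (R, M) \<noteq> 0 \<longleftrightarrow> inn j"
  shows "runs (program A B) (init_state xs) (poly (time_poly A B) n) (\<lambda>s. \<exists>p own.
    auction_inv adj n p own \<and> (\<forall>i<n. auction_settled adj n p own i) \<and>
    fst s 0 = card {j. j < n \<and> p j \<noteq> 0} - card {j. j < n \<and> inn j})" (is "runs _ _ _ ?Q")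
proof -
  define R0 where "R0 = fst (init_state xs)"
  define M0 where "M0 = snd (init_state xs)"
  have M0: "M0 a = (if a < 1 + n * n + n then xs ! a else 0)" for a
    using xs by (simp add: M0_def init_state_def)
  let ?T3 = "max_time count_init + ((n + 1) * (4 + max_time (count_body B)) + max_time finish)"
  let ?T2 = "max_time auction_init + ((n * (n + 2) * (n + 1) + n + 1) *
    (4 + (max_time scan_init + ((n + 1) * (4 + max_time (scan_body A)) + max_time bid))) + ?T3)"
  \<comment> \<open>The phases are verified from the last to the first, each serving as the
    postcondition of the one before.\<close>
  have 3: "runs (Seq count_init (Seq (count B) finish)) (R, M) ?T3 ?Q"
    if L: "layout n ((!) xs) R M" and inv: "auction_inv adj n (price n M) (owner n M)"
      "\<forall>i<n. auction_settled adj n (price n M) (owner n M) i" for R M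
  proof (intro runs_Seq runs_loop_free)
    show "loop_free count_init" by (simp add: count_init_def)
    define R' where "R' = R(6 := 0, 11 := 0, 12 := 0)"
    have init: "result count_init (R, M) = (R', M)" by (simp add: count_init_def R'_def)
    have L': "layout n ((!) xs) R' M" using L by (simp add: layout_def R'_def)
    show "runs (count B) (result count_init (R, M)) ((n + 1) * (4 + max_time (count_body B)))
      (\<lambda>s. runs finish s (max_time finish) ?Q)"
      unfolding init
    proof (intro runs_count[where inn = inn, OF _ L'] runs_loop_free)
      show "R' 6 = 0" "R' 11 = 0" "R' 12 = 0" by (simp_all add: R'_def)
      show "loop_free finish" by (simp add: finish_def)
      fix R :: "nat \<Rightarrow> nat"
      assume "R 11 = card {j. j < n \<and> price n M j \<noteq> 0}" "R 12 = card {j. j < n \<and> inn j}"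
      then show "?Q (result finish (R, M))"
        using inv by (intro exI[of _ "price n M"] exI[of _ "owner n M"]) (simp add: finish_def)
    qed (use B in blast)
  qed
  have 2: "runs (Seq auction_init (Seq (auction A) (Seq count_init (Seq (count B) finish)))) (R, M0) ?T2 ?Q"
    if R: "R 1 = n" "R 2 = 1 + n * n" for R
  proof (intro runs_Seq[of auction_init] runs_Seq[of "auction A"] runs_loop_free)
    show "loop_free auction_init" by (simp add: auction_init_def)
    define R' where "R' = R(3 := 1 + n * n + n, 4 := 1 + n * n + n + n, 5 := 0, 7 := 1)"
    have init: "result auction_init (R, M0) = (R', M0)"
      using R by (simp add: auction_init_def R'_def)
    have L: "layout n ((!) xs) R' M0" using R M0 by (simp add: layout_def R'_def)
    show "runs (auction A) (result auction_init (R, M0)) ((n * (n + 2) * (n + 1) + n + 1) *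
      (4 + (max_time scan_init + ((n + 1) * (4 + max_time (scan_body A)) + max_time bid))))
      (\<lambda>s. runs (Seq count_init (Seq (count B) finish)) s ?T3 ?Q)"
      unfolding init
    proof (rule runs_auction[where adj = adj, OF _ L])
      show "R' 5 = 0" "R' 7 = 1" by (simp_all add: R'_def)
      show "M0 a = 0" if "1 + n * n + n \<le> a" for a using M0 that by simp
    qed (use A 3 in \<open>blast+\<close>)
  qed
  show ?thesis unfolding program_def poly_time_poly
  proof (intro runs_Seq[of square_init] runs_Seq[of square] runs_loop_free)
    show "loop_free square_init" by (simp add: square_init_def)
    have init: "result square_init (init_state xs) = (R0(1 := n, 2 := 1), M0)"
      using M0[of 0] xs by (simp add: square_init_def R0_def M0_def)
    show "runs square (result square_init (init_state xs)) ((n + 1) * (4 + max_time square_body))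
      (\<lambda>s. runs (Seq auction_init (Seq (auction A) (Seq count_init (Seq (count B) finish)))) s ?T2 ?Q)"
      unfolding init
    proof (rule runs_square)
      show "(R0(1 := n, 2 := 1)) 1 = n" "(R0(1 := n, 2 := 1)) 2 = 1" by simp_all
      show "(R0(1 := n, 2 := 1)) 5 = 0" by (simp add: R0_def init_state_def)
    qed (rule 2)
  qed
qed

section \<open>Expressions testing inner layers and adjacency\<close>

definition colorE :: "nat \<Rightarrow> exp" where
  "colorE i = Mem (Add (Reg 2) (Reg i))"

text \<open>\<open>cs\<close> lists the color numbers along the path. As \<open>H\<close> is fixed,
  the disjunction over its inner positions unrolls into an expression of constant size.\<close>

definition innerE :: "nat list \<Rightarrow> exp" where
  "innerE cs = sumE (map (\<lambda>t. eqE (colorE 6) (Const (cs ! t))) [1..<length cs - 1])"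

text \<open>The first list joins the two copies of an inner vertex, the second gives the edges from
  position \<open>t\<close> to the next.\<close>

definition adjE :: "nat list \<Rightarrow> exp" where
  "adjE cs = sumE
    (map (\<lambda>t. bothE (eqE (Reg 5) (Reg 6)) (eqE (colorE 5) (Const (cs ! t)))) [1..<length cs - 1] @
     map (\<lambda>t. bothE (Mem (Add (Reg 7) (Reg 6)))
       (bothE (eqE (colorE 5) (Const (cs ! t))) (eqE (colorE 6) (Const (cs ! Suc t))))) [0..<length cs - 1])"

lemma val_colorE:
  assumes "layout n inp R M" "R r < n"
  shows "val (colorE r) (R, M) = inp (1 + n * n + R r)"
  using assms by (simp add: colorE_def layout_def)

context layered_graph
begin

lemma val_innerE:
  assumes L: "layout n inp R M" and j: "R 6 < n"
    and color: "\<And>v t. v < n \<Longrightarrow> t < k \<Longrightarrow> inp (1 + n * n + v) = cs ! t \<longleftrightarrow> layer v = t"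
    and cs: "length cs = k"
  shows "val (innerE cs) (R, M) \<noteq> 0 \<longleftrightarrow> inner (R 6)"
proof -
  have "val (innerE cs) (R, M) = 0 \<longleftrightarrow>
      (\<forall>t\<in>{1..<k - 1}. inp (1 + n * n + R 6) \<noteq> cs ! t)"
    by (simp add: innerE_def val_sumE_eq_0 val_eqE val_colorE[OF L j] cs)
  also have "\<dots> \<longleftrightarrow> (\<forall>t\<in>{1..<k - 1}. layer (R 6) \<noteq> t)"
    by (intro ball_cong refl arg_cong[where f = Not] color[OF j]) auto
  also have "\<dots> \<longleftrightarrow> \<not> inner (R 6)" by (auto simp: inner_def)
  finally show ?thesis by simp
qed

lemma val_adjE:
  assumes L: "layout n inp R M" and ij: "R 5 < n" "R 6 < n" and row: "R 7 = 1 + R 5 * n"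
    and color: "\<And>v t. v < n \<Longrightarrow> t < k \<Longrightarrow> inp (1 + n * n + v) = cs ! t \<longleftrightarrow> layer v = t"
    and edge: "\<And>u v. u < n \<Longrightarrow> v < n \<Longrightarrow> inp (1 + u * n + v) = (if (u, v) \<in> E then 1 else 0)"
    and cs: "length cs = k"
  shows "val (adjE cs) (R, M) \<noteq> 0 \<longleftrightarrow> split_adj (R 5) (R 6)"
proof -
  \<comment> \<open>The matrix entry lies within the input, where \<open>layout\<close> guarantees
    that memory is unchanged.\<close>
  have "R 5 * n + R 6 < Suc (R 5) * n" using ij by simp
  also have "\<dots> \<le> n * n" using ij by (intro mult_right_mono) auto
  finally have e: "val (Mem (Add (Reg 7) (Reg 6))) (R, M) = (if (R 5, R 6) \<in> E then 1 else 0)"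
    using L row edge[OF ij] by (simp add: layout_def)
  note vals = val_bothE val_eqE val_colorE[OF L ij(1)] val_colorE[OF L ij(2)]
  have same: "val (bothE (eqE (Reg 5) (Reg 6)) (eqE (colorE 5) (Const (cs ! t)))) (R, M) = 0 \<longleftrightarrow>
      \<not> (R 5 = R 6 \<and> inp (1 + n * n + R 5) = cs ! t)" for t
    by (simp add: vals)
  have arc: "val (bothE (Mem (Add (Reg 7) (Reg 6)))
       (bothE (eqE (colorE 5) (Const (cs ! t))) (eqE (colorE 6) (Const (cs ! Suc t))))) (R, M) = 0 \<longleftrightarrow>
      \<not> ((R 5, R 6) \<in> E \<and> inp (1 + n * n + R 5) = cs ! t \<and> inp (1 + n * n + R 6) = cs ! Suc t)" for t
    by (simp add: vals e del: val.simps(3))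
  have "val (adjE cs) (R, M) = 0 \<longleftrightarrow>
    (\<forall>t\<in>{1..<k - 1}. \<not> (R 5 = R 6 \<and> inp (1 + n * n + R 5) = cs ! t)) \<and>
    (\<forall>t\<in>{0..<k - 1}. \<not> ((R 5, R 6) \<in> E \<and> inp (1 + n * n + R 5) = cs ! t \<and>
       inp (1 + n * n + R 6) = cs ! Suc t))"
    unfolding adjE_def val_sumE_eq_0
    by (simp only: ball_Un set_append set_map ball_simps same arc cs set_upt)
  also have "\<dots> \<longleftrightarrow> (\<forall>t\<in>{1..<k - 1}. \<not> (R 5 = R 6 \<and> layer (R 5) = t)) \<and>
    (\<forall>t\<in>{0..<k - 1}. \<not> ((R 5, R 6) \<in> E \<and> layer (R 5) = t \<and> layer (R 6) = Suc t))"
    by (intro arg_cong2[where f = "(\<and>)"] ball_cong arg_cong[where f = Not] refl color[OF ij(1)] color[OF ij(2)]) auto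
  also have "\<dots> \<longleftrightarrow> \<not> split_adj (R 5) (R 6)"
    using layer[OF ij(2)] by (auto simp: split_adj_def inner_def)
  finally show ?thesis by simp
qed

end

section \<open>The encoding\<close>

lemma nth_concat_rows:
  assumes "u < m" "v < n"
  shows "concat (map (\<lambda>u. map (f u) [0..<n]) [0..<m]) ! (u * n + v) = f u v"
  using assms(1)
proof (induction m)
  case (Suc m)
  have len: "length (concat (map (\<lambda>u. map (f u) [0..<n]) [0..<m])) = m * n"
    by (simp add: length_concat comp_def sum_list_triv)
  show ?case
  proof (cases "u < m")
    case True
    have "u * n + v < Suc u * n" using assms by simp
    also have "\<dots> \<le> m * n" using True by (intro mult_right_mono) auto
    finally show ?thesis using Suc.IH[OF True] len by (simp add: nth_append)
  next
    case False
    then have "u = m" using Suc.prems by simp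
    then show ?thesis using len assms(2) by (simp add: nth_append)
  qed
qed simp

context
  fixes G :: "nat pair_pre_digraph" and \<sigma> :: "nat \<Rightarrow> 'h" and code :: "'h \<Rightarrow> nat" and n :: nat
  assumes verts: "pverts G = {0..<n}"
begin

abbreviation (input) arc_bit :: "nat \<Rightarrow> nat \<Rightarrow> nat" where
  "arc_bit u v \<equiv> if (u, v) \<in> parcs G then 1 else 0"

abbreviation (input) arc_rows :: "nat list" where
  "arc_rows \<equiv> concat (map (\<lambda>u. map (arc_bit u) [0..<n]) [0..<n])"

lemma encode_eq: "encode_instance code (G, \<sigma>) = n # arc_rows @ map (\<lambda>v. code (\<sigma> v)) [0..<n]"
  using verts by (simp add: encode_instance_def Let_def)

lemma length_rows: "length arc_rows = n * n"
  by (simp add: length_concat comp_def sum_list_triv)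

lemma length_encode: "length (encode_instance code (G, \<sigma>)) = 1 + n * n + n"
  and encode_size: "encode_instance code (G, \<sigma>) ! 0 = n"
  using length_rows by (simp_all add: encode_eq)

lemma encode_color: "v < n \<Longrightarrow> encode_instance code (G, \<sigma>) ! (1 + n * n + v) = code (\<sigma> v)"
  using length_rows by (simp add: encode_eq nth_append)

lemma encode_arc:
  assumes "u < n" "v < n"
  shows "encode_instance code (G, \<sigma>) ! (1 + u * n + v) = arc_bit u v"
proof -
  have "u * n + v < Suc u * n" using assms by simp
  also have "\<dots> \<le> n * n" using assms by (intro mult_right_mono) auto
  finally show ?thesis
    using nth_concat_rows[OF assms, of arc_bit] length_rows by (simp add: encode_eq nth_append)
qed

end

section \<open>From time in the number of vertices to time in the input size\<close>

lemma length_le_input_size: "length xs \<le> input_size xs"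
  by (induction xs) (auto simp: input_size_def)

text \<open>A bound in any parameter not exceeding the input length suffices: each number
  contributes a separator bit, and polynomials with natural coefficients are monotone.\<close>

lemma poly_time_solvableI:
  assumes "\<And>x. x \<in> I \<Longrightarrow> \<exists>n \<le> length (enc x). runs c (init_state (enc x)) (poly p n) (\<lambda>s. fst s 0 = f x)"
  shows "poly_time_solvable enc I f"
  unfolding poly_time_solvable_def
proof (rule exI, rule exI, rule ballI)
  fix x assume "x \<in> I"
  then obtain n t s where *: "n \<le> length (enc x)" "exec c (init_state (enc x)) t s" "t \<le> poly p n"
      "fst s 0 = f x"
    using assms unfolding runs_def by metis
  have "poly p n \<le> poly p (input_size (enc x))"
    using *(1) length_le_input_size[of "enc x"] by (intro poly_nat_mono) simp
  then show "\<exists>t s. exec c (init_state (enc x)) t s \<and> t \<le> poly p (input_size (enc x)) \<and> fst s 0 = f x"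
    using * by (meson le_trans)
qed

theorem theorem14:
  fixes H :: "'h pair_pre_digraph"
  assumes "path_graph H"
  shows "hitting_poly_time_solvable H"
  unfolding hitting_poly_time_solvable_def
proof (intro allI impI)
  fix code :: "'h \<Rightarrow> nat" assume code: "inj_on code (pverts H)"
  obtain vs where vs: "vs \<noteq> []" "distinct vs" "pverts H = set vs"
    and arcs: "parcs H = {(vs ! i, vs ! Suc i) | i. Suc i < length vs} \<union>
                {(vs ! Suc i, vs ! i) | i. Suc i < length vs}"
    using assms by (auto simp: path_graph_def)
  show "poly_time_solvable (encode_instance code) (hitting_instances H)
    (\<lambda>(G, \<sigma>). hitting_number H G \<sigma>)"
  \<comment> \<open>For a single vertex the answer is the number of vertices of \<open>G\<close>,
    found at address 0; the program takes 3 time units.\<close>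
  proof (cases "length vs = 1")
    case True
    then obtain a where "vs = [a]" by (metis One_nat_def length_0_conv length_Suc_conv)
    then have H: "pverts H = {a}" "parcs H = {}" using vs arcs by auto
    show ?thesis
    proof (rule poly_time_solvableI[where c = "Assign 0 (Mem (Const 0))" and p = "[:3:]"])
      fix x assume "x \<in> hitting_instances H"
      then obtain G \<sigma> n where x: "x = (G, \<sigma>)" and G: "pverts G = {0..<n}" "is_coloring H G \<sigma>"
        by (auto simp: hitting_instances_def)
      let ?s = "init_state (encode_instance code x)"
      have "snd ?s 0 = n"
        using encode_size[OF G(1), of code \<sigma>] length_encode[OF G(1), of code \<sigma>] by (simp add: init_state_def x)
      moreover have "hitting_number H G \<sigma> = n"
        using hitting_number_single[OF H _ G(2)] G(1) by simp
      ultimately have "runs (Assign 0 (Mem (Const 0))) ?s (max_time (Assign 0 (Mem (Const 0))))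
          (\<lambda>s. fst s 0 = (case x of (G, \<sigma>) \<Rightarrow> hitting_number H G \<sigma>))"
        by (intro runs_loop_free) (simp_all add: x)
      then show "\<exists>n\<le>length (encode_instance code x). runs (Assign 0 (Mem (Const 0))) ?s (poly [:3:] n)
          (\<lambda>s. fst s 0 = (case x of (G, \<sigma>) \<Rightarrow> hitting_number H G \<sigma>))"
        by (intro exI[of _ 0]) (simp add: numeral_3_eq_3)
    qed
  next
    case False
    define k where "k = length vs"
    have k: "2 \<le> k" using False vs(1) by (cases vs) (auto simp: k_def Suc_le_eq)
    define cs where "cs = map code vs"
    have cs: "length cs = k" by (simp add: cs_def k_def)
    let ?c = "program (adjE cs) (innerE cs)" and ?p = "time_poly (adjE cs) (innerE cs)"
    show ?thesis
    proof (rule poly_time_solvableI[where c = ?c and p = ?p])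
      fix x assume "x \<in> hitting_instances H"
      then obtain G \<sigma> n where x: "x = (G, \<sigma>)" and G: "pair_graph G" "pverts G = {0..<n}"
        and \<sigma>: "is_coloring H G \<sigma>"
        by (auto simp: hitting_instances_def)
      \<comment> \<open>The position of the color of \<open>v\<close> on the path, which exists for
        all \<open>v < n\<close>.\<close>
      define layer where "layer v = (SOME t. t < k \<and> vs ! t = \<sigma> v)" for v
      have layer_color: "layer v < k \<and> vs ! layer v = \<sigma> v" if "v < n" for v
      proof -
        have "\<sigma> v \<in> set vs" using \<sigma> G vs(3) that by (auto simp: is_coloring_def)
        then have "\<exists>t. t < k \<and> vs ! t = \<sigma> v" by (simp add: k_def in_set_conv_nth)
        then show ?thesis unfolding layer_def by (rule someI_ex)
      qed
      interpret layered_graph n k "parcs G" layer by unfold_locales (use k layer_color in auto)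
      let ?xs = "encode_instance code (G, \<sigma>)"
      \<comment> \<open>Injectivity of \<open>code\<close> and distinctness of \<open>vs\<close> let
        the stored color number determine the layer.\<close>
      have color: "?xs ! (1 + n * n + v) = cs ! t \<longleftrightarrow> layer v = t" if "v < n" "t < k" for v t
      proof -
        have "?xs ! (1 + n * n + v) = cs ! t \<longleftrightarrow> code (vs ! layer v) = code (vs ! t)"
          using encode_color[OF G(2) that(1), of code \<sigma>] that layer_color[OF that(1)] by (simp add: cs_def k_def)
        also have "\<dots> \<longleftrightarrow> vs ! layer v = vs ! t"
        proof (rule inj_on_eq_iff[OF code])
          show "vs ! layer v \<in> pverts H" "vs ! t \<in> pverts H"
            using layer_color[OF that(1)] that(2) vs(3) unfolding k_def by (metis nth_mem)+
        qed
        also have "\<dots> \<longleftrightarrow> layer v = t"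
          using layer_color[OF that(1)] that(2) unfolding k_def by (metis nth_eq_iff_index_eq[OF vs(2)])
        finally show ?thesis .
      qed
      have "runs ?c (init_state ?xs) (poly ?p n) (\<lambda>s. \<exists>p own. auction_inv split_adj n p own \<and>
        (\<forall>i<n. auction_settled split_adj n p own i) \<and>
        fst s 0 = card {j. j < n \<and> p j \<noteq> 0} - card {j. j < n \<and> inner j})"
      proof (rule runs_program)
        show "length ?xs = 1 + n * n + n" "?xs ! 0 = n"
          using length_encode[OF G(2), of code \<sigma>] encode_size[OF G(2), of code \<sigma>] by simp_all
        then show "?xs \<noteq> []" by auto
        fix R M assume L: "layout n ((!) ?xs) R M"
        show "val (adjE cs) (R, M) \<noteq> 0 \<longleftrightarrow> split_adj i j"
          if "R 5 = i" "R 6 = j" "i < n" "j < n" "R 7 = 1 + i * n" for i j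
          using val_adjE[OF L, of cs] that color encode_arc[OF G(2), where code = code and \<sigma> = \<sigma>] cs by blast
        show "val (innerE cs) (R, M) \<noteq> 0 \<longleftrightarrow> inner j" if "R 6 = j" "j < n" for j
          using val_innerE[OF L, of cs] that color cs by blast
      qed
      moreover have "hitting_number H G \<sigma> = Min (card ` {X. hits_paths X})"
        using hitting_number_layered[OF vs(2,3) arcs G, of layer \<sigma>] layer_color layered_graph_axioms
        by (simp add: k_def)
      ultimately have "runs ?c (init_state ?xs) (poly ?p n) (\<lambda>s. fst s 0 = hitting_number H G \<sigma>)"
        by (elim runs_mono) (auto simp: auction_computes_hitting)
      moreover have "n \<le> length ?xs" using length_encode[OF G(2), of code \<sigma>] by simp
      ultimately show "\<exists>n\<le>length (encode_instance code x). runs ?c (init_state (encode_instance code x))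
          (poly ?p n) (\<lambda>s. fst s 0 = (case x of (G, \<sigma>) \<Rightarrow> hitting_number H G \<sigma>))"
        unfolding x by auto
    qed
  qed
qed

end
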